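(* Let $G$ be an $r$-regular graph on $n$ vertices, $0\le r\le n-1$, let $m\ge1$, and let $1/2<\alpha<1$. Then $G$ is determined by its $A_\alpha$-spectrum if and only if $G\vee K_m$ is determined by its $A_\alpha$-spectrum.
   Context: All graphs are finite, simple and undirected. For a graph $G$, $A(G)$ is its adjacency matrix, $D(G)$ its diagonal degree matrix, and $A_\alpha(G)=\alpha D(G)+(1-\alpha)A(G)$. A graph is determined by its $A_\alpha$-spectrum if every graph whose $A_\alpha$ matrix has the same multiset of eigenvalues is isomorphic to it. $K_m$ is the complete graph on $m$ vertices and $G\vee H$ is the join (disjoint union plus all edges between the two vertex sets). *)

theory Defs
  imports "Jordan_Normal_Form.Char_Poly" "HOL-Computational_Algebra.Polynomial"
begin

definition is_graph :: "nat \<Rightarrow> (nat \<Rightarrow> nat \<Rightarrow> bool) \<Rightarrow> bool" where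
  "is_graph n E \<longleftrightarrow> (\<forall>i j. E i j \<longrightarrow> i < n \<and> j < n) \<and> (\<forall>i j. E i j = E j i) \<and> (\<forall>i. \<not> E i i)"

definition degree :: "nat \<Rightarrow> (nat \<Rightarrow> nat \<Rightarrow> bool) \<Rightarrow> nat \<Rightarrow> nat" where
  "degree n E i = card {j. j < n \<and> E i j}"

definition regular :: "nat \<Rightarrow> (nat \<Rightarrow> nat \<Rightarrow> bool) \<Rightarrow> nat \<Rightarrow> bool" where
  "regular n E r \<longleftrightarrow> (\<forall>i<n. degree n E i = r)"

definition adj_mat :: "nat \<Rightarrow> (nat \<Rightarrow> nat \<Rightarrow> bool) \<Rightarrow> real mat" where
  "adj_mat n E = mat n n (\<lambda>(i,j). if E i j then 1 else 0)"

definition deg_mat :: "nat \<Rightarrow> (nat \<Rightarrow> nat \<Rightarrow> bool) \<Rightarrow> real mat" where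
  "deg_mat n E = mat n n (\<lambda>(i,j). if i = j then real (degree n E i) else 0)"

definition A_alpha :: "real \<Rightarrow> nat \<Rightarrow> (nat \<Rightarrow> nat \<Rightarrow> bool) \<Rightarrow> real mat" where
  "A_alpha \<alpha> n E = \<alpha> \<cdot>\<^sub>m deg_mat n E + (1 - \<alpha>) \<cdot>\<^sub>m adj_mat n E"

definition eigenvalue_mset :: "real mat \<Rightarrow> complex multiset" where
  "eigenvalue_mset M = proots (map_poly complex_of_real (char_poly M))"

definition A_alpha_spectrum :: "real \<Rightarrow> nat \<Rightarrow> (nat \<Rightarrow> nat \<Rightarrow> bool) \<Rightarrow> complex multiset" where
  "A_alpha_spectrum \<alpha> n E = eigenvalue_mset (A_alpha \<alpha> n E)"

definition graph_iso :: "nat \<Rightarrow> (nat \<Rightarrow> nat \<Rightarrow> bool) \<Rightarrow> nat \<Rightarrow> (nat \<Rightarrow> nat \<Rightarrow> bool) \<Rightarrow> bool" where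
  "graph_iso n E n' E' \<longleftrightarrow> (\<exists>f. bij_betw f {..<n} {..<n'} \<and> (\<forall>i<n. \<forall>j<n. E i j = E' (f i) (f j)))"

text \<open>Every finite simple graph is isomorphic to one on {0..<k}, so quantifying over those suffices.\<close>
definition determined_by_A_alpha_spectrum :: "real \<Rightarrow> nat \<Rightarrow> (nat \<Rightarrow> nat \<Rightarrow> bool) \<Rightarrow> bool" where
  "determined_by_A_alpha_spectrum \<alpha> n E \<longleftrightarrow>
     (\<forall>n' E'. is_graph n' E' \<and> A_alpha_spectrum \<alpha> n' E' = A_alpha_spectrum \<alpha> n E \<longrightarrow> graph_iso n' E' n E)"

definition complete_graph :: "nat \<Rightarrow> nat \<Rightarrow> nat \<Rightarrow> bool" where
  "complete_graph m i j \<longleftrightarrow> i < m \<and> j < m \<and> i \<noteq> j"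

definition graph_join :: "nat \<Rightarrow> (nat \<Rightarrow> nat \<Rightarrow> bool) \<Rightarrow> nat \<Rightarrow> (nat \<Rightarrow> nat \<Rightarrow> bool) \<Rightarrow> nat \<Rightarrow> nat \<Rightarrow> bool" where
  "graph_join n E m F i j \<longleftrightarrow>
     (i < n \<and> j < n \<and> E i j)
   \<or> (n \<le> i \<and> i < n + m \<and> n \<le> j \<and> j < n + m \<and> F (i - n) (j - n))
   \<or> (i < n \<and> n \<le> j \<and> j < n + m)
   \<or> (n \<le> i \<and> i < n + m \<and> j < n)"

end

theory Submission
  imports Defs
begin

text \<open>
  The traces of the matrix and of its square give the sums of the degrees and of their squares, so
  a cospectral mate of a regular graph is regular; and for \<open>r\<close>-regular \<open>G\<close> the characteristic
  polynomial of the join of \<open>G\<close> with the clique is that of \<open>G\<close>, shifted, times a factor depending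
  only on \<open>n\<close>, \<open>m\<close>, \<open>r\<close>, \<open>\<alpha>\<close>. Hence everything reduces to showing that a graph \<open>H\<close> on \<open>N = n + m\<close>
  vertices that is cospectral with the join has \<open>m\<close> dominating vertices.

  Put \<open>M = (\<alpha> N - 1) I - A\<^sub>\<alpha>(H)\<close>, which is the matrix \<open>C\<close> of the complement of \<open>H\<close> minus \<open>1 - \<alpha>\<close>
  times the all-ones matrix. For \<open>\<alpha> > 1/2\<close> the matrix \<open>C\<close> is positive semidefinite and its kernel
  consists of the vectors supported on the dominating vertices of \<open>H\<close>. Since \<open>M\<close> has a negative
  eigenvalue and agrees with \<open>C\<close> on the vectors with sum 0, its kernel, which has dimension at
  least \<open>m - 1\<close>, consists of vectors with sum 0 in the kernel of \<open>C\<close>. This settles \<open>m \<ge> 2\<close>. For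
  \<open>m = 1\<close> and \<open>M\<close> invertible, the spectral measure of the all-ones vector has the same moments up
  to order two as for the join, where it lives on two points; a Gauss quadrature inequality for
  \<open>1/y\<close> then forces the preimage of the all-ones vector under \<open>M\<close> into the kernel of \<open>C\<close>.
\<close>

section \<open>Real symmetric matrices\<close>

lemma symmetric_mat_scalar_prod:
  assumes "(A :: real mat) \<in> carrier_mat n n" "A\<^sup>T = A" "x \<in> carrier_vec n" "y \<in> carrier_vec n"
  shows "(A *\<^sub>v x) \<bullet> y = x \<bullet> (A *\<^sub>v y)"
  using transpose_vec_mult_scalar[OF assms(1,4,3)] assms(2) by simp

lemma scalar_prod_self_pos:
  assumes "(v :: real vec) \<in> carrier_vec n" "v \<noteq> 0\<^sub>v n"
  shows "0 < v \<bullet> v"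
  using conjugate_square_greater_0_vec[OF assms(1)] assms(2)
  by (simp add: scalar_prod_def conjugate_vec_def)

text \<open>Over the complex numbers the polynomial splits. Pairing \<open>B *\<^sub>v v\<close>
  with the conjugate of an eigenvector \<open>v\<close> and moving the symmetric matrix to the other
  side gives \<open>a = cnj a\<close>, so all roots are real and the factorization descends.\<close>

lemma real_symmetric_char_poly_splits:
  fixes A :: "real mat"
  assumes A: "A \<in> carrier_mat n n" and sym: "A\<^sup>T = A"
  shows "\<exists>es. char_poly A = (\<Prod>e\<leftarrow>es. [:- e, 1:])"
proof -
  let ?h = "complex_of_real"
  define B where "B = map_mat ?h A"
  have B: "B \<in> carrier_mat n n" using A by (simp add: B_def)
  have symB: "B\<^sup>T = B" unfolding B_def by (rule eq_matI) (use A sym in \<open>auto simp: mat_eq_iff\<close>)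
  have cp: "char_poly B = map_poly ?h (char_poly A)"
    unfolding B_def by (rule of_real_hom.char_poly_hom[OF A])
  obtain as where as: "char_poly B = (\<Prod>a\<leftarrow>as. [:- a, 1:])"
    using char_poly_factorized[OF B] by blast
  have real: "?h (Re a) = a" if "a \<in> set as" for a
  proof -
    have "poly (char_poly B) a = 0"
      unfolding as using that by (auto simp: poly_prod_list prod_list_zero_iff o_def)
    then obtain v where v: "v \<in> carrier_vec n" "v \<noteq> 0\<^sub>v n" "B *\<^sub>v v = a \<cdot>\<^sub>v v"
      using eigenvalue_root_char_poly[OF B] B unfolding eigenvalue_def eigenvector_def by auto
    have cv: "conjugate v \<in> carrier_vec n" using v by simp
    have "B *\<^sub>v conjugate v = conjugate (B *\<^sub>v v)"
      using A v(1) by (intro eq_vecI) (auto simp: B_def scalar_prod_def conjugate_complex_def)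
    hence Bc: "B *\<^sub>v conjugate v = cnj a \<cdot>\<^sub>v conjugate v"
      unfolding v(3) by (simp add: conjugate_smult_vec conjugate_complex_def)
    have "(B\<^sup>T *\<^sub>v v) \<bullet> conjugate v = v \<bullet> (B *\<^sub>v conjugate v)"
      by (rule transpose_vec_mult_scalar[OF B cv v(1)])
    hence "a * (v \<bullet>c v) = cnj a * (v \<bullet>c v)"
      unfolding symB v(3) Bc using v cv by simp
    moreover have "v \<bullet>c v \<noteq> 0" using conjugate_square_eq_0_vec[OF v(1)] v(2) by simp
    ultimately have "a = cnj a" by simp
    thus ?thesis by (metis Reals_cnj_iff of_real_Re)
  qed
  interpret H: map_poly_inj_idom_hom complex_of_real ..
  have "map_poly ?h (\<Prod>e\<leftarrow>map Re as. [:- e, 1:]) = (\<Prod>a\<leftarrow>as. [:- a, 1:])"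
    using real
  proof (induction as)
    case (Cons a as)
    have "map_poly ?h [:- Re a, 1:] = [:- a, 1:]" using Cons.prems[of a] by simp
    moreover have "map_poly ?h (\<Prod>e\<leftarrow>map Re as. [:- e, 1:]) = (\<Prod>a\<leftarrow>as. [:- a, 1:])"
      by (rule Cons.IH) (use Cons.prems in simp)
    ultimately show ?case by (simp only: list.map prod_list.Cons H.hom_mult)
  qed simp
  hence "map_poly ?h (char_poly A) = map_poly ?h (\<Prod>e\<leftarrow>map Re as. [:- e, 1:])"
    using cp as by simp
  hence "char_poly A = (\<Prod>e\<leftarrow>map Re as. [:- e, 1:])" by (simp only: H.eq_iff)
  thus ?thesis by blast
qed

text \<open>The reflection in the hyperplane orthogonal to \<open>v - unit_vec n 0\<close> swaps
  these two unit vectors. It serves to make a unit eigenvector the first basis vector.\<close>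

lemma householder_reflection:
  fixes v :: "real vec"
  assumes v: "v \<in> carrier_vec n" and norm: "v \<bullet> v = 1" and n: "0 < n"
  shows "\<exists>W \<in> carrier_mat n n. W\<^sup>T = W \<and> W * W = 1\<^sub>m n \<and> W *\<^sub>v unit_vec n 0 = v"
proof (cases "v = unit_vec n 0")
  case True
  thus ?thesis by (intro bexI[of _ "1\<^sub>m n"]) auto
next
  case False
  define w where "w = v - unit_vec n 0"
  have w: "w \<in> carrier_vec n" using v by (simp add: w_def)
  have "w \<noteq> 0\<^sub>v n"
  proof
    assume "w = 0\<^sub>v n"
    have "v $ i = unit_vec n 0 $ i" if "i < n" for i
      using arg_cong[OF \<open>w = 0\<^sub>v n\<close>, of "\<lambda>x. x $ i"] that v by (simp add: w_def)
    thus False using False v by (auto intro: eq_vecI)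
  qed
  hence ww: "w \<bullet> w \<noteq> 0" using scalar_prod_self_pos[OF w] by simp
  have w0: "w \<bullet> w = - 2 * w $ 0"
  proof -
    have "w \<bullet> w = v \<bullet> v - 2 * v $ 0 + 1"
      unfolding w_def using v n
      by (simp add: minus_scalar_prod_distrib[of _ n] scalar_prod_minus_distrib[of _ n])
    thus ?thesis using norm v n by (simp add: w_def)
  qed
  define k where "k = 2 / (w \<bullet> w)"
  \<comment> \<open>The first identity makes \<open>W\<close> an involution. The second, which rests
    on \<open>v\<close> having length 1, makes \<open>W\<close> send the unit vector
    \<open>e\<close> with index 0 to \<open>e + w = v\<close>.\<close>
  have k: "k * (w \<bullet> w) = 2" "k * w $ 0 = -1" using ww w0 by (auto simp: k_def field_simps)
  define W where "W = mat n n (\<lambda>(i,j). (if i = j then 1 else 0) - k * w $ i * w $ j)"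
  have W: "W \<in> carrier_mat n n" by (simp add: W_def)
  have "W * W = 1\<^sub>m n"
  proof (rule eq_matI)
    fix i j assume ij: "i < dim_row (1\<^sub>m n :: real mat)" "j < dim_col (1\<^sub>m n :: real mat)"
    have "(W * W) $$ (i,j) = (\<Sum>l = 0..<n. ((if i = l then 1 else 0) - k * w $ i * w $ l) *
        ((if l = j then 1 else 0) - k * w $ l * w $ j))"
      using ij by (simp add: W_def scalar_prod_def)
    also have "\<dots> = (\<Sum>l = 0..<n. (if i = l then (if l = j then 1 else 0) else 0)
        - (if i = l then k * w $ l * w $ j else 0) - (if l = j then k * w $ i * w $ l else 0)
        + k * k * w $ i * w $ j * (w $ l * w $ l))"
      by (intro sum.cong refl) (auto simp: algebra_simps)
    also have "\<dots> = (if i = j then 1 else 0) - 2 * (k * w $ i * w $ j)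
        + k * w $ i * w $ j * (k * (\<Sum>l = 0..<n. w $ l * w $ l))"
      using ij by (simp add: sum.distrib sum_subtractf sum_distrib_left[symmetric] mult.assoc)
    also have "(\<Sum>l = 0..<n. w $ l * w $ l) = w \<bullet> w" using w by (simp add: scalar_prod_def)
    finally show "(W * W) $$ (i,j) = 1\<^sub>m n $$ (i,j)" using k ij by simp
  qed (auto simp: W_def)
  moreover have "W\<^sup>T = W" by (rule eq_matI) (auto simp: W_def)
  moreover have "W *\<^sub>v unit_vec n 0 = v"
  proof (rule eq_vecI)
    fix i assume "i < dim_vec v"
    hence i: "i < n" using v by simp
    have "(W *\<^sub>v unit_vec n 0) $ i = (if i = 0 then 1 else 0) - k * w $ 0 * w $ i"
      using i n by (simp add: W_def)
    also have "\<dots> = v $ i" unfolding k using i n v by (simp add: w_def)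
    finally show "(W *\<^sub>v unit_vec n 0) $ i = v $ i" .
  qed (use v in \<open>auto simp: W_def\<close>)
  ultimately show ?thesis using W by blast
qed

definition diag_of_list :: "real list \<Rightarrow> real mat" where
  "diag_of_list es = mat (length es) (length es) (\<lambda>(i,j). if i = j then es ! i else 0)"

lemma diag_of_list_carrier [simp]: "diag_of_list es \<in> carrier_mat (length es) (length es)"
  by (simp add: diag_of_list_def)

lemma mult_mat_assoc4:
  assumes "(A :: 'a :: semiring_1 mat) \<in> carrier_mat n n" "B \<in> carrier_mat n n" "C \<in> carrier_mat n n"
    "D \<in> carrier_mat n n" "E \<in> carrier_mat n n"
  shows "A * (B * C * D) * E = (A * B) * C * (D * E)"
  using assms by (simp add: assoc_mult_mat[of _ n n _ n _ n])

text \<open>Deflation: a Householder reflection splits off the first root as a block of size 1, and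
  the other block has the remaining roots. The list \<open>es\<close> is prescribed, so that two
  matrices with the same characteristic polynomial receive the same diagonal factor.\<close>

lemma spectral_theorem_list:
  fixes A :: "real mat"
  assumes "A \<in> carrier_mat n n" and "A\<^sup>T = A" and "char_poly A = (\<Prod>e\<leftarrow>es. [:- e, 1:])"
  shows "length es = n \<and>
    (\<exists>Q \<in> carrier_mat n n. Q\<^sup>T * Q = 1\<^sub>m n \<and> A = Q * diag_of_list es * Q\<^sup>T)"
  using assms
proof (induction es arbitrary: n A)
  case Nil
  hence "n = 0" using degree_monic_char_poly[of A n] by simp
  thus ?case using Nil by (auto intro!: bexI[of _ "1\<^sub>m 0"] simp: diag_of_list_def)
next
  case (Cons e es n A)
  note A = Cons.prems(1) and sym = Cons.prems(2)
  have root: "poly (char_poly A) e = 0" unfolding Cons.prems(3) by simp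
  then obtain v0 where v0: "v0 \<in> carrier_vec n" "v0 \<noteq> 0\<^sub>v n" "A *\<^sub>v v0 = e \<cdot>\<^sub>v v0"
    using eigenvalue_root_char_poly[OF A] A unfolding eigenvalue_def eigenvector_def by auto
  have pos: "v0 \<bullet> v0 > 0" by (rule scalar_prod_self_pos[OF v0(1,2)])
  define v where "v = (1 / sqrt (v0 \<bullet> v0)) \<cdot>\<^sub>v v0"
  have v: "v \<in> carrier_vec n" using v0 by (simp add: v_def)
  have vv: "v \<bullet> v = 1" using pos v0(1) by (simp add: v_def real_sqrt_mult[symmetric])
  have Av: "A *\<^sub>v v = e \<cdot>\<^sub>v v"
    unfolding v_def mult_mat_vec[OF A v0(1)] v0(3) by (simp add: smult_smult_assoc mult.commute)
  have n: "0 < n"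
  proof (rule ccontr)
    assume "\<not> 0 < n"
    thus False using v0 by auto
  qed
  then obtain k where k: "n = Suc k" by (cases n) auto
  obtain W where W: "W \<in> carrier_mat n n" "W\<^sup>T = W" "W * W = 1\<^sub>m n" "W *\<^sub>v unit_vec n 0 = v"
    using householder_reflection[OF v vv n] by blast
  define A' where "A' = W * A * W"
  have A': "A' \<in> carrier_mat n n" using W A by (simp add: A'_def)
  have symA': "A'\<^sup>T = A'"
    unfolding A'_def using W A sym
    by (simp add: transpose_mult[of _ n n _ n] assoc_mult_mat[of _ n n _ n _ n])
  have "W *\<^sub>v v = unit_vec n 0"
    using assoc_mult_mat_vec[OF W(1,1), of "unit_vec n 0"] W by simp
  moreover have "A' *\<^sub>v unit_vec n 0 = W *\<^sub>v (A *\<^sub>v (W *\<^sub>v unit_vec n 0))"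
    unfolding A'_def using W A by (simp add: assoc_mult_mat_vec[of _ n n _ n])
  ultimately have A'e: "A' *\<^sub>v unit_vec n 0 = e \<cdot>\<^sub>v unit_vec n 0"
    unfolding W(4) Av using W v by (simp add: mult_mat_vec[of _ n n])
  have col0: "A' $$ (i,0) = (if i = 0 then e else 0)" if "i < n" for i
  proof -
    have "A' $$ (i,0) = (A' *\<^sub>v unit_vec n 0) $ i" using that A' n by simp
    thus ?thesis unfolding A'e using that n by simp
  qed
  have row0: "A' $$ (0,i) = (if i = 0 then e else 0)" if "i < n" for i
    using col0[OF that] arg_cong[OF symA', of "\<lambda>X. X $$ (0,i)"] A' that n by simp
  define A3 where "A3 = mat k k (\<lambda>(i,j). A' $$ (Suc i, Suc j))"
  define A1 where "A1 = mat 1 1 (\<lambda>_. e)"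
  have A3: "A3 \<in> carrier_mat k k" and A1: "A1 \<in> carrier_mat 1 1"
    by (auto simp: A3_def A1_def)
  have symA3: "A3\<^sup>T = A3"
  proof (rule eq_matI)
    fix i j assume "i < dim_row A3" "j < dim_col A3"
    thus "A3\<^sup>T $$ (i,j) = A3 $$ (i,j)"
      using arg_cong[OF symA', of "\<lambda>X. X $$ (Suc i,Suc j)"] A' k by (simp add: A3_def)
  qed (auto simp: A3_def)
  \<comment> \<open>Column 0 of \<open>A'\<close> is \<open>e\<close> times a unit vector because
    that vector is an eigenvector; symmetry gives the same for row 0.\<close>
  have block: "A' = four_block_mat A1 (0\<^sub>m 1 k) (0\<^sub>m k 1) A3"
    using A' k col0 row0 by (intro eq_matI) (auto simp: A1_def A3_def)
  have "similar_mat A' A"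
    unfolding similar_mat_def
    by (rule exI[of _ W], rule exI[of _ W], rule similar_mat_witI[of _ _ n])
      (use W A A' in \<open>auto simp: A'_def\<close>)
  hence cpA': "char_poly A' = char_poly A" by (rule char_poly_similar)
  have "char_poly A' = [:-e,1:] * (\<Prod>e\<leftarrow>es. [:- e, 1:])"
    unfolding cpA' Cons.prems(3) by simp
  moreover have "char_poly A' = char_poly A1 * char_poly A3"
    unfolding block by (rule char_poly_four_block_zeros_col[OF A1 _ A3]) simp
  moreover have "char_poly A1 = [: -e,1 :]"
    by (simp add: A1_def char_poly_defs det_def sign_def)
  ultimately have "char_poly A3 = (\<Prod>e\<leftarrow>es. [:- e, 1:])"
    by (metis mult_cancel_left pCons_eq_0_iff zero_neq_one)
  from Cons.IH[OF A3 symA3 this] obtain Q3 where len: "length es = k" and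
    Q3: "Q3 \<in> carrier_mat k k" "Q3\<^sup>T * Q3 = 1\<^sub>m k" "A3 = Q3 * diag_of_list es * Q3\<^sup>T" by blast
  define Q' where "Q' = four_block_mat (1\<^sub>m 1) (0\<^sub>m 1 k) (0\<^sub>m k 1) Q3"
  have Q': "Q' \<in> carrier_mat n n"
    unfolding Q'_def using four_block_carrier_mat[OF one_carrier_mat[of 1] Q3(1)] k by simp
  have Q'T: "Q'\<^sup>T = four_block_mat (1\<^sub>m 1) (0\<^sub>m 1 k) (0\<^sub>m k 1) Q3\<^sup>T"
    unfolding Q'_def by (subst transpose_four_block_mat[of _ 1 1 _ k _ k]) (use Q3 in auto)
  have D: "diag_of_list (e # es) = four_block_mat A1 (0\<^sub>m 1 k) (0\<^sub>m k 1) (diag_of_list es)"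
    using len by (intro eq_matI) (auto simp: A1_def diag_of_list_def nth_Cons')
  have ds: "diag_of_list es \<in> carrier_mat k k" "diag_of_list (e # es) \<in> carrier_mat n n"
    using len k diag_of_list_carrier[of es] diag_of_list_carrier[of "e # es"] by auto
  have Q'Q': "Q'\<^sup>T * Q' = 1\<^sub>m n"
    unfolding Q'T unfolding Q'_def
    by (subst mult_four_block_mat[of _ 1 1 _ k _ k])
      (use Q3 k in \<open>auto simp: four_block_one_mat\<close>)
  have "Q' * diag_of_list (e # es) = four_block_mat A1 (0\<^sub>m 1 k) (0\<^sub>m k 1) (Q3 * diag_of_list es)"
    unfolding Q'_def D
    by (subst mult_four_block_mat[of _ 1 1 _ k _ k]) (use Q3 ds A1 in auto)
  hence A'Q': "Q' * diag_of_list (e # es) * Q'\<^sup>T = A'"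
    unfolding Q'T block Q3(3)
    by (simp, subst mult_four_block_mat[of _ 1 1 _ k _ k]) (use Q3 ds A1 in auto)
  define Q where "Q = W * Q'"
  have Q: "Q \<in> carrier_mat n n" using W Q' by (simp add: Q_def)
  have QT: "Q\<^sup>T = Q'\<^sup>T * W" unfolding Q_def using W Q' by (simp add: transpose_mult[of _ n n _ n])
  have "Q\<^sup>T * Q = Q'\<^sup>T * (W * W) * Q'"
    unfolding QT unfolding Q_def using W(1) Q' by (simp add: assoc_mult_mat[of _ n n _ n _ n])
  hence "Q\<^sup>T * Q = 1\<^sub>m n" using W Q' Q'Q' by simp
  moreover have "Q * diag_of_list (e # es) * Q\<^sup>T = W * A' * W"
    unfolding QT A'Q'[symmetric] unfolding Q_def
    by (rule mult_mat_assoc4[symmetric]) (use W Q' ds in auto)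
  moreover have "W * A' * W = A"
    unfolding A'_def using mult_mat_assoc4[OF W(1,1) A W(1,1)] W A by simp
  ultimately show ?case using Q len k by auto
qed

text \<open>Both matrices are diagonalized to the same \<open>D\<close>, by \<open>Q\<close> and
  \<open>R\<close>; then \<open>R * Q\<^sup>T\<close> carries one to the other.\<close>

lemma orthogonally_similar_if_char_poly_eq:
  fixes A B :: "real mat"
  assumes A: "A \<in> carrier_mat n n" "A\<^sup>T = A" and B: "B \<in> carrier_mat n n" "B\<^sup>T = B"
    and cp: "char_poly A = char_poly B"
  shows "\<exists>P \<in> carrier_mat n n. P * P\<^sup>T = 1\<^sub>m n \<and> P\<^sup>T * P = 1\<^sub>m n \<and> A = P\<^sup>T * B * P"
proof -
  obtain es where es: "char_poly A = (\<Prod>e\<leftarrow>es. [:- e, 1:])"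
    using real_symmetric_char_poly_splits[OF A] by blast
  define D where "D = diag_of_list es"
  obtain Q where len: "length es = n" and Q: "Q \<in> carrier_mat n n" "Q\<^sup>T * Q = 1\<^sub>m n" "A = Q * D * Q\<^sup>T"
    using spectral_theorem_list[OF A es] by (auto simp: D_def)
  obtain R where R: "R \<in> carrier_mat n n" "R\<^sup>T * R = 1\<^sub>m n" "B = R * D * R\<^sup>T"
    using spectral_theorem_list[OF B] es cp by (auto simp: D_def)
  have D: "D \<in> carrier_mat n n" using len by (auto simp: D_def)
  have QQ: "Q * Q\<^sup>T = 1\<^sub>m n" using mat_mult_left_right_inverse[of "Q\<^sup>T" n Q] Q by simp
  have RR: "R * R\<^sup>T = 1\<^sub>m n" using mat_mult_left_right_inverse[of "R\<^sup>T" n R] R by simp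
  have QT: "Q\<^sup>T \<in> carrier_mat n n" and RT: "R\<^sup>T \<in> carrier_mat n n" using Q R by auto
  define P where "P = R * Q\<^sup>T"
  have P: "P \<in> carrier_mat n n" using Q R by (simp add: P_def)
  have PT: "P\<^sup>T = Q * R\<^sup>T" unfolding P_def using Q R by (simp add: transpose_mult[of _ n n _ n])
  have "P\<^sup>T * P = Q * (R\<^sup>T * R) * Q\<^sup>T"
    unfolding PT unfolding P_def using Q(1) R(1) by (simp add: assoc_mult_mat[of _ n n _ n _ n])
  hence 1: "P\<^sup>T * P = 1\<^sub>m n" using Q(1) QQ R(2) by simp
  hence 2: "P * P\<^sup>T = 1\<^sub>m n" using mat_mult_left_right_inverse[of "P\<^sup>T" n P] P by simp
  have "P\<^sup>T * B * P = Q * (R\<^sup>T * (R * D * R\<^sup>T) * R) * Q\<^sup>T"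
    unfolding PT R(3) unfolding P_def using Q(1) R(1) D by (simp add: assoc_mult_mat[of _ n n _ n _ n])
  also have "R\<^sup>T * (R * D * R\<^sup>T) * R = D"
    using mult_mat_assoc4[OF RT R(1) D RT R(1)] R(2) D by simp
  finally have "A = P\<^sup>T * B * P" using Q(3) by simp
  thus ?thesis using P 1 2 by blast
qed

lemma diag_of_list_mult_vec:
  assumes "u \<in> carrier_vec (length es)"
  shows "diag_of_list es *\<^sub>v u = vec (length es) (\<lambda>i. es ! i * u $ i)"
  using assms
  by (intro eq_vecI) (auto simp: diag_of_list_def scalar_prod_def if_distrib[of "\<lambda>x. x * _"] cong: if_cong)

text \<open>In an eigenbasis the left-hand side is a sum of the nonnegative numbers e (e - a) u^2.\<close>

lemma quadratic_form_nonneg_if_spectral_gap: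
  fixes A :: "real mat"
  assumes A: "A \<in> carrier_mat n n" "A\<^sup>T = A"
    and gap: "\<And>e. eigenvalue A e \<Longrightarrow> 0 \<le> e * (e - a)"
    and z: "z \<in> carrier_vec n"
  shows "0 \<le> (A *\<^sub>v z) \<bullet> (A *\<^sub>v z) - a * (z \<bullet> (A *\<^sub>v z))"
proof -
  obtain es where es: "char_poly A = (\<Prod>e\<leftarrow>es. [:- e, 1:])"
    using real_symmetric_char_poly_splits[OF A] by blast
  define D where "D = diag_of_list es"
  obtain Q where len: "length es = n" and Q: "Q \<in> carrier_mat n n" "Q\<^sup>T * Q = 1\<^sub>m n" "A = Q * D * Q\<^sup>T"
    using spectral_theorem_list[OF A es] by (auto simp: D_def)
  have D: "D \<in> carrier_mat n n" using len by (auto simp: D_def)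
  define u where "u = Q\<^sup>T *\<^sub>v z"
  have u: "u \<in> carrier_vec n" using Q z by (simp add: u_def)
  define d where "d = D *\<^sub>v u"
  have d: "d = vec n (\<lambda>i. es ! i * u $ i)"
    unfolding d_def D_def using diag_of_list_mult_vec[of u es] u len by simp
  have dc: "d \<in> carrier_vec n" by (simp add: d)
  have Az: "A *\<^sub>v z = Q *\<^sub>v d"
    unfolding Q(3) d_def u_def using Q(1) D z by (simp add: assoc_mult_mat_vec[of _ n n _ n])
  have "(A *\<^sub>v z) \<bullet> (A *\<^sub>v z) = (Q\<^sup>T *\<^sub>v (Q *\<^sub>v d)) \<bullet> d"
    unfolding Az using transpose_vec_mult_scalar[OF Q(1) dc, of "Q *\<^sub>v d"] Q dc by simp
  also have "Q\<^sup>T *\<^sub>v (Q *\<^sub>v d) = d"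
    using assoc_mult_mat_vec[of "Q\<^sup>T" n n Q n d] Q dc by simp
  finally have 1: "(A *\<^sub>v z) \<bullet> (A *\<^sub>v z) = (\<Sum>i = 0..<n. (es ! i * u $ i) * (es ! i * u $ i))"
    by (simp add: d scalar_prod_def)
  have "z \<bullet> (A *\<^sub>v z) = u \<bullet> d"
    unfolding Az u_def using transpose_vec_mult_scalar[OF Q(1) dc z] by simp
  hence 2: "z \<bullet> (A *\<^sub>v z) = (\<Sum>i = 0..<n. u $ i * (es ! i * u $ i))"
    by (simp add: d scalar_prod_def)
  have "0 \<le> es ! i * (es ! i - a)" if "i < n" for i
  proof (rule gap)
    have "es ! i \<in> set es" using that len by simp
    hence "poly (char_poly A) (es ! i) = 0"
      unfolding es by (auto simp: poly_prod_list prod_list_zero_iff o_def)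
    thus "eigenvalue A (es ! i)" using eigenvalue_root_char_poly[OF A(1)] by simp
  qed
  hence "0 \<le> (\<Sum>i = 0..<n. (es ! i * (es ! i - a)) * (u $ i)\<^sup>2)"
    by (intro sum_nonneg mult_nonneg_nonneg[OF _ zero_le_power2]) simp
  also have "\<dots> = (A *\<^sub>v z) \<bullet> (A *\<^sub>v z) - a * (z \<bullet> (A *\<^sub>v z))"
    unfolding 1 2 sum_distrib_left sum_subtractf[symmetric]
    by (intro sum.cong refl) (simp add: power2_eq_square algebra_simps)
  finally show ?thesis .
qed

section \<open>The matrix and its characteristic polynomial\<close>

lemma A_alpha_carrier [simp]: "A_alpha \<alpha> n E \<in> carrier_mat n n"
  by (simp add: A_alpha_def deg_mat_def adj_mat_def)

lemma A_alpha_dim [simp]: "dim_row (A_alpha \<alpha> n E) = n" "dim_col (A_alpha \<alpha> n E) = n"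
  using A_alpha_carrier[of \<alpha> n E] by (blast dest: carrier_matD)+

lemma A_alpha_index:
  assumes "i < n" "j < n"
  shows "A_alpha \<alpha> n E $$ (i,j) =
    (if i = j then \<alpha> * real (degree n E i) else 0) + (1 - \<alpha>) * (if E i j then 1 else 0)"
  using assms by (simp add: A_alpha_def deg_mat_def adj_mat_def)

lemma A_alpha_symmetric:
  assumes "is_graph n E"
  shows "(A_alpha \<alpha> n E)\<^sup>T = A_alpha \<alpha> n E"
proof (rule eq_matI)
  have "E i j = E j i" for i j using assms unfolding is_graph_def by blast
  thus "(A_alpha \<alpha> n E)\<^sup>T $$ (i,j) = A_alpha \<alpha> n E $$ (i,j)"
    if "i < dim_row (A_alpha \<alpha> n E)" "j < dim_col (A_alpha \<alpha> n E)" for i j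
    using that by (simp add: A_alpha_index)
qed auto

lemma sum_adjacency:
  "(\<Sum>j = 0..<n. if E i j then 1 else 0 :: real) = real (degree n E i)"
proof -
  have "(\<Sum>j = 0..<n. if E i j then 1 else 0 :: real) = real (card ({0..<n} \<inter> {j. E i j}))"
    by (simp add: sum.If_cases)
  also have "{0..<n} \<inter> {j. E i j} = {j. j < n \<and> E i j}" by auto
  finally show ?thesis by (simp add: degree_def)
qed

lemma A_alpha_row_sum:
  assumes "i < n"
  shows "(\<Sum>j = 0..<n. A_alpha \<alpha> n E $$ (i,j)) = real (degree n E i)"
proof -
  have "(\<Sum>j = 0..<n. A_alpha \<alpha> n E $$ (i,j)) =
      (\<Sum>j = 0..<n. (if i = j then \<alpha> * real (degree n E i) else 0) + (1 - \<alpha>) * (if E i j then 1 else 0))"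
    using assms by (intro sum.cong refl A_alpha_index) auto
  also have "\<dots> = \<alpha> * real (degree n E i) + (1 - \<alpha>) * real (degree n E i)"
    using assms by (simp only: sum.distrib sum_distrib_left[symmetric] sum_adjacency) simp
  finally show ?thesis by (simp add: algebra_simps)
qed

text \<open>The characteristic polynomial is monic and splits over the complex numbers, so its
  multiset of roots recovers it, and the number of roots is the order of the graph.\<close>

lemma A_alpha_spectrum_eq_iff:
  "A_alpha_spectrum \<alpha> n E = A_alpha_spectrum \<alpha> n' E' \<longleftrightarrow>
    n = n' \<and> char_poly (A_alpha \<alpha> n E) = char_poly (A_alpha \<alpha> n' E')"
proof
  define p where "p = map_poly complex_of_real (char_poly (A_alpha \<alpha> n E))"
  define q where "q = map_poly complex_of_real (char_poly (A_alpha \<alpha> n' E'))"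
  interpret H: map_poly_inj_idom_hom complex_of_real ..
  assume "A_alpha_spectrum \<alpha> n E = A_alpha_spectrum \<alpha> n' E'"
  hence eq: "proots p = proots q"
    by (simp add: A_alpha_spectrum_def eigenvalue_mset_def p_def q_def)
  have p: "Polynomial.degree p = n" "lead_coeff p = 1"
    using degree_monic_char_poly[OF A_alpha_carrier[of \<alpha> n E]] by (auto simp: p_def)
  have q: "Polynomial.degree q = n'" "lead_coeff q = 1"
    using degree_monic_char_poly[OF A_alpha_carrier[of \<alpha> n' E']] by (auto simp: q_def)
  have "n = n'" using size_proots_complex[of p] size_proots_complex[of q] eq p q by simp
  moreover have "p = q"
    using complex_poly_decompose_multiset[of p] complex_poly_decompose_multiset[of q] eq
    unfolding p(2) q(2) by simp
  ultimately show "n = n' \<and> char_poly (A_alpha \<alpha> n E) = char_poly (A_alpha \<alpha> n' E')"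
    unfolding p_def q_def by (simp only: H.eq_iff simp_thms)
qed (elim conjE, simp only: A_alpha_spectrum_def eigenvalue_mset_def)

section \<open>Traces and degree sums\<close>

lemma trace_mult_comm:
  fixes X Y :: "real mat"
  assumes "X \<in> carrier_mat n n" "Y \<in> carrier_mat n n"
  shows "(\<Sum>i = 0..<n. (X * Y) $$ (i,i)) = (\<Sum>i = 0..<n. (Y * X) $$ (i,i))"
proof -
  have "(\<Sum>i = 0..<n. (X * Y) $$ (i,i)) = (\<Sum>i = 0..<n. \<Sum>j = 0..<n. X $$ (i,j) * Y $$ (j,i))"
    using assms by (intro sum.cong refl) (simp add: scalar_prod_def)
  also have "\<dots> = (\<Sum>j = 0..<n. \<Sum>i = 0..<n. Y $$ (j,i) * X $$ (i,j))"
    by (subst sum.swap) (simp add: mult.commute)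
  also have "\<dots> = (\<Sum>i = 0..<n. (Y * X) $$ (i,i))"
    using assms by (intro sum.cong refl) (simp add: scalar_prod_def)
  finally show ?thesis .
qed

lemma trace_conjugate:
  fixes B P :: "real mat"
  assumes "P \<in> carrier_mat n n" "B \<in> carrier_mat n n" "P * P\<^sup>T = 1\<^sub>m n"
  shows "(\<Sum>i = 0..<n. (P\<^sup>T * B * P) $$ (i,i)) = (\<Sum>i = 0..<n. B $$ (i,i))"
proof -
  have "(\<Sum>i = 0..<n. (P\<^sup>T * B * P) $$ (i,i)) = (\<Sum>i = 0..<n. (P * (P\<^sup>T * B)) $$ (i,i))"
    using assms by (intro trace_mult_comm) auto
  also have "P * (P\<^sup>T * B) = B"
    using assms by (simp add: assoc_mult_mat[of _ n n _ n _ n, symmetric])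
  finally show ?thesis .
qed

lemma degree_sums_A_alpha:
  assumes "is_graph n E"
  shows "(\<Sum>i = 0..<n. A_alpha \<alpha> n E $$ (i,i)) = \<alpha> * (\<Sum>i = 0..<n. real (degree n E i))"
    and "(\<Sum>i = 0..<n. (A_alpha \<alpha> n E * A_alpha \<alpha> n E) $$ (i,i)) =
      \<alpha>\<^sup>2 * (\<Sum>i = 0..<n. (real (degree n E i))\<^sup>2) + (1 - \<alpha>)\<^sup>2 * (\<Sum>i = 0..<n. real (degree n E i))"
proof -
  have irr: "\<not> E i i" and symE: "E i j = E j i" for i j using assms unfolding is_graph_def by blast+
  show "(\<Sum>i = 0..<n. A_alpha \<alpha> n E $$ (i,i)) = \<alpha> * (\<Sum>i = 0..<n. real (degree n E i))"
    by (simp add: A_alpha_index irr sum_distrib_left)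
  have "(A_alpha \<alpha> n E * A_alpha \<alpha> n E) $$ (i,i) =
      \<alpha>\<^sup>2 * (real (degree n E i))\<^sup>2 + (1 - \<alpha>)\<^sup>2 * real (degree n E i)" if "i < n" for i
  proof -
    have "(A_alpha \<alpha> n E * A_alpha \<alpha> n E) $$ (i,i) =
        (\<Sum>j = 0..<n. A_alpha \<alpha> n E $$ (i,j) * A_alpha \<alpha> n E $$ (j,i))"
      using that by (simp add: scalar_prod_def)
    \<comment> \<open>There are no loops, so the degree part sits only on the diagonal and the
      adjacency part only off it: no mixed terms arise.\<close>
    also have "\<dots> = (\<Sum>j = 0..<n. (if i = j then \<alpha>\<^sup>2 * (real (degree n E i))\<^sup>2 else 0)
        + (1 - \<alpha>)\<^sup>2 * (if E i j then 1 else 0))"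
      using that irr symE by (intro sum.cong refl) (auto simp: A_alpha_index power2_eq_square)
    also have "\<dots> = \<alpha>\<^sup>2 * (real (degree n E i))\<^sup>2 + (1 - \<alpha>)\<^sup>2 * real (degree n E i)"
      using that by (simp only: sum.distrib sum_distrib_left[symmetric] sum_adjacency) simp
    finally show ?thesis .
  qed
  thus "(\<Sum>i = 0..<n. (A_alpha \<alpha> n E * A_alpha \<alpha> n E) $$ (i,i)) =
      \<alpha>\<^sup>2 * (\<Sum>i = 0..<n. (real (degree n E i))\<^sup>2) + (1 - \<alpha>)\<^sup>2 * (\<Sum>i = 0..<n. real (degree n E i))"
    by (simp add: sum.distrib sum_distrib_left)
qed

text \<open>Orthogonal similarity preserves the traces of the matrix and of its square. The first is
  \<alpha> times the degree sum; once that is known, the second yields the sum of squares after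
  division by \<open>\<alpha>\<^sup>2\<close>.\<close>

lemma cospectral_degree_sums:
  assumes E: "is_graph n E" and F: "is_graph n F" and \<alpha>: "\<alpha> \<noteq> 0"
    and cp: "char_poly (A_alpha \<alpha> n E) = char_poly (A_alpha \<alpha> n F)"
  shows "(\<Sum>i = 0..<n. real (degree n E i)) = (\<Sum>i = 0..<n. real (degree n F i))"
    and "(\<Sum>i = 0..<n. (real (degree n E i))\<^sup>2) = (\<Sum>i = 0..<n. (real (degree n F i))\<^sup>2)"
proof -
  define A where "A = A_alpha \<alpha> n E"
  define B where "B = A_alpha \<alpha> n F"
  have A: "A \<in> carrier_mat n n" "A\<^sup>T = A" and B: "B \<in> carrier_mat n n" "B\<^sup>T = B"
    using A_alpha_symmetric E F by (auto simp: A_def B_def)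
  obtain P where P: "P \<in> carrier_mat n n" "P * P\<^sup>T = 1\<^sub>m n" "P\<^sup>T * P = 1\<^sub>m n" "A = P\<^sup>T * B * P"
    using orthogonally_similar_if_char_poly_eq[OF A B] cp by (auto simp: A_def B_def)
  have "A * A = P\<^sup>T * B * (P * P\<^sup>T) * B * P"
    unfolding P(4) using P(1) B by (simp add: assoc_mult_mat[of _ n n _ n _ n])
  also have "\<dots> = P\<^sup>T * (B * B) * P"
    unfolding P(2) using P(1) B by (simp add: assoc_mult_mat[of _ n n _ n _ n])
  finally have "(\<Sum>i = 0..<n. (A * A) $$ (i,i)) = (\<Sum>i = 0..<n. (B * B) $$ (i,i))"
    using trace_conjugate[OF P(1) _ P(2), of "B * B"] B by simp
  moreover have "(\<Sum>i = 0..<n. A $$ (i,i)) = (\<Sum>i = 0..<n. B $$ (i,i))"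
    unfolding P(4) by (rule trace_conjugate[OF P(1) B(1) P(2)])
  ultimately show "(\<Sum>i = 0..<n. real (degree n E i)) = (\<Sum>i = 0..<n. real (degree n F i))"
    and "(\<Sum>i = 0..<n. (real (degree n E i))\<^sup>2) = (\<Sum>i = 0..<n. (real (degree n F i))\<^sup>2)"
    unfolding A_def B_def degree_sums_A_alpha[OF E] degree_sums_A_alpha[OF F] using \<alpha> by auto
qed

text \<open>The two sums make the total squared deviation of the degrees from \<open>r\<close> equal
  to 0.\<close>

lemma regular_if_degree_sums:
  assumes "(\<Sum>i = 0..<n. real (degree n E i)) = real n * real r"
    and "(\<Sum>i = 0..<n. (real (degree n E i))\<^sup>2) = real n * (real r)\<^sup>2"
  shows "regular n E r"
proof -
  have "(\<Sum>i = 0..<n. (real (degree n E i) - real r)\<^sup>2) =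
      (\<Sum>i = 0..<n. (real (degree n E i))\<^sup>2 - 2 * real r * real (degree n E i) + (real r)\<^sup>2)"
    by (intro sum.cong refl) (simp add: power2_diff algebra_simps)
  also have "\<dots> = 0"
    unfolding sum.distrib sum_subtractf sum_distrib_left[symmetric] assms by (simp add: power2_eq_square)
  finally have "\<forall>i \<in> {0..<n}. (real (degree n E i) - real r)\<^sup>2 = 0"
    by (subst (asm) sum_nonneg_eq_0_iff) auto
  thus ?thesis by (simp add: regular_def)
qed

lemma degree_sums_if_regular:
  assumes "regular n E r"
  shows "(\<Sum>i = 0..<n. real (degree n E i)) = real n * real r"
    and "(\<Sum>i = 0..<n. (real (degree n E i))\<^sup>2) = real n * (real r)\<^sup>2"
  using assms by (auto simp: regular_def)

lemma regular_if_cospectral: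
  assumes "is_graph n E" "is_graph n F" "\<alpha> \<noteq> 0" "regular n F r"
    and "char_poly (A_alpha \<alpha> n E) = char_poly (A_alpha \<alpha> n F)"
  shows "regular n E r"
  using regular_if_degree_sums cospectral_degree_sums[OF assms(1-3,5)] degree_sums_if_regular[OF assms(4)]
  by metis

section \<open>Isomorphisms\<close>

lemma graph_iso_trans:
  assumes "graph_iso n E n' E'" "graph_iso n' E' n'' E''"
  shows "graph_iso n E n'' E''"
proof -
  obtain f where f: "bij_betw f {..<n} {..<n'}" "\<forall>i<n. \<forall>j<n. E i j = E' (f i) (f j)"
    using assms unfolding graph_iso_def by blast
  obtain g where g: "bij_betw g {..<n'} {..<n''}" "\<forall>i<n'. \<forall>j<n'. E' i j = E'' (g i) (g j)"
    using assms unfolding graph_iso_def by blast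
  have "f i < n'" if "i < n" for i using that bij_betwE[OF f(1)] by auto
  thus ?thesis unfolding graph_iso_def
    using bij_betw_trans[OF f(1) g(1)] f(2) g(2) by (intro exI[of _ "g \<circ> f"]) auto
qed

lemma iso_preserves_degree:
  assumes f: "bij_betw f {..<n} {..<n'}" and iso: "\<forall>i<n. \<forall>j<n. E i j = E' (f i) (f j)" and i: "i < n"
  shows "degree n' E' (f i) = degree n E i"
proof -
  have "{j. j < n' \<and> E' (f i) j} = f ` {j. j < n \<and> E i j}"
  proof (intro equalityI subsetI)
    fix y assume y: "y \<in> {j. j < n' \<and> E' (f i) j}"
    hence "y \<in> f ` {..<n}" using bij_betw_imp_surj_on[OF f] by simp
    then obtain j where "j < n" "y = f j" by auto
    with y show "y \<in> f ` {j. j < n \<and> E i j}" using iso i by auto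
  qed (use bij_betwE[OF f] iso i in auto)
  moreover have "inj_on f {j. j < n \<and> E i j}"
    using f unfolding bij_betw_def by (auto intro: inj_on_subset)
  ultimately show ?thesis by (simp add: degree_def card_image)
qed

text \<open>Rows and columns each contribute the sign of \<open>p\<close>, and its square is 1. The
  columns are treated as rows of the transpose.\<close>

lemma det_permute_rows_cols:
  fixes X :: "'a :: comm_ring_1 mat"
  assumes X: "X \<in> carrier_mat n n" and p: "p permutes {0..<n}"
  shows "det (mat n n (\<lambda>(i,j). X $$ (p i, p j))) = det X"
proof -
  define Y where "Y = mat n n (\<lambda>(i,j). X\<^sup>T $$ (p i, j))"
  have Y: "Y \<in> carrier_mat n n" by (simp add: Y_def)
  have pn: "p i < n" if "i < n" for i using permutes_in_image[OF p, of i] that by simp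
  have "mat n n (\<lambda>(i,j). X $$ (p i, p j)) = mat n n (\<lambda>(i,j). Y\<^sup>T $$ (p i, j))"
    by (rule eq_matI) (use X pn in \<open>auto simp: Y_def\<close>)
  hence "det (mat n n (\<lambda>(i,j). X $$ (p i, p j))) = signof p * det Y"
    using det_permute_rows[of "Y\<^sup>T" n p] Y p det_transpose[OF Y] by simp
  also have "det Y = signof p * det X"
    unfolding Y_def using det_permute_rows[of "X\<^sup>T" n p] X p det_transpose[OF X] by simp
  also have "signof p * (signof p * det X) = det X"
    by (simp add: sign_def)
  finally show ?thesis .
qed

lemma graph_iso_char_poly:
  assumes "graph_iso n E n F"
  shows "char_poly (A_alpha \<alpha> n E) = char_poly (A_alpha \<alpha> n F)"
proof -
  obtain f where f: "bij_betw f {..<n} {..<n}" and iso: "\<forall>i<n. \<forall>j<n. E i j = F (f i) (f j)"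
    using assms unfolding graph_iso_def by blast
  \<comment> \<open>The isomorphism is continued by the identity, since \<open>permutes\<close>
    requires a map that fixes everything outside the index set.\<close>
  define p where "p i = (if i < n then f i else i)" for i
  have "bij_betw p {..<n} {..<n}" using f by (subst bij_betw_cong[of _ _ f]) (auto simp: p_def)
  hence p: "p permutes {0..<n}" unfolding lessThan_atLeast0 by (rule bij_imp_permutes) (auto simp: p_def)
  have pn: "p i < n" if "i < n" for i using permutes_in_image[OF p, of i] that by simp
  have inj: "p i = p j \<longleftrightarrow> i = j" for i j using permutes_inj[OF p] by (auto dest: injD)
  have deg: "degree n F (p i) = degree n E i" if "i < n" for i
    using iso_preserves_degree[OF f iso that] that by (simp add: p_def)
  have adj: "F (p i) (p j) = E i j" if "i < n" "j < n" for i j using iso that by (simp add: p_def)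
  have "char_poly_matrix (A_alpha \<alpha> n E) =
      mat n n (\<lambda>(i,j). char_poly_matrix (A_alpha \<alpha> n F) $$ (p i, p j))"
    by (rule eq_matI) (auto simp: char_poly_matrix_def A_alpha_index pn inj deg adj)
  thus ?thesis
    unfolding char_poly_def using det_permute_rows_cols[OF char_poly_matrix_closed[OF A_alpha_carrier] p] by metis
qed

section \<open>Joins with complete graphs\<close>

lemma is_graph_join:
  assumes "is_graph n E"
  shows "is_graph (n + m) (graph_join n E m (complete_graph m))"
  using assms unfolding is_graph_def graph_join_def complete_graph_def by auto

lemma degree_join_left:
  assumes "i < n"
  shows "degree (n + m) (graph_join n E m (complete_graph m)) i = degree n E i + m"
proof -
  have "{j. j < n + m \<and> graph_join n E m (complete_graph m) i j} = {j. j < n \<and> E i j} \<union> {n..<n+m}"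
    using assms unfolding graph_join_def by auto
  moreover have "card ({j. j < n \<and> E i j} \<union> {n..<n+m}) = card {j. j < n \<and> E i j} + card {n..<n+m}"
    by (rule card_Un_disjoint) auto
  ultimately show ?thesis by (simp add: degree_def)
qed

lemma degree_join_right:
  assumes "n \<le> i" "i < n + m"
  shows "degree (n + m) (graph_join n E m (complete_graph m)) i = n + m - 1"
proof -
  have "{j. j < n + m \<and> graph_join n E m (complete_graph m) i j} = {..<n+m} - {i}"
    using assms unfolding graph_join_def complete_graph_def by auto
  thus ?thesis unfolding degree_def using assms by simp
qed

lemma graph_join_iso:
  assumes "graph_iso n E n F"
  shows "graph_iso (n + m) (graph_join n E m (complete_graph m)) (n + m) (graph_join n F m (complete_graph m))"
proof -
  obtain f where f: "bij_betw f {..<n} {..<n}" and iso: "\<forall>i<n. \<forall>j<n. E i j = F (f i) (f j)"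
    using assms unfolding graph_iso_def by blast
  define g where "g i = (if i < n then f i else i)" for i
  have g1: "bij_betw g {..<n} {..<n}" using f by (subst bij_betw_cong[of _ _ f]) (auto simp: g_def)
  have g2: "bij_betw g {n..<n+m} {n..<n+m}"
    by (subst bij_betw_cong[of _ _ "\<lambda>x. x"]) (auto simp: g_def bij_betw_def)
  have un: "{..<n} \<union> {n..<n+m} = {..<n+m}" and disj: "{..<n} \<inter> {n..<n+m} = {}" by auto
  have g: "bij_betw g {..<n+m} {..<n+m}" using bij_betw_combine[OF g1 g2 disj] unfolding un .
  have "f i < n" "\<not> n \<le> f i" if "i < n" for i using bij_betwE[OF f] that by (auto simp: not_le)
  hence "\<forall>i<n+m. \<forall>j<n+m. graph_join n E m (complete_graph m) i j =
      graph_join n F m (complete_graph m) (g i) (g j)"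
    using iso by (auto simp: graph_join_def g_def)
  thus ?thesis unfolding graph_iso_def using g by blast
qed

text \<open>The determinant of the Schur complement of the block of \<open>G\<close> in
  \<open>x I - A_alpha\<close> of the join. Regularity makes the all-ones vector an eigenvector of
  that block for \<open>x - \<alpha> m - r\<close>, which is why only this number is
  inverted.\<close>

definition join_factor :: "nat \<Rightarrow> nat \<Rightarrow> nat \<Rightarrow> real \<Rightarrow> real \<Rightarrow> real" where
  "join_factor n m r \<alpha> x = det (mat m m (\<lambda>(i,j).
     (if i = j then x - \<alpha> * real (n + m - 1) else - (1 - \<alpha>))
     - (1 - \<alpha>)\<^sup>2 * real n / (x - \<alpha> * real m - real r)))"

lemma poly_char_poly_det:
  fixes A :: "real mat"
  assumes "A \<in> carrier_mat n n"
  shows "poly (char_poly A) x = det (mat n n (\<lambda>(i,j). (if i = j then x else 0) - A $$ (i,j)))"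
proof -
  have "poly (char_poly A) x = det (- char_matrix A x)" by (rule char_poly_matrix[OF assms])
  also have "- char_matrix A x = mat n n (\<lambda>(i,j). (if i = j then x else 0) - A $$ (i,j))"
    using assms by (intro eq_matI) (auto simp: char_matrix_def)
  finally show ?thesis .
qed

text \<open>The rows of the upper left block have constant sum, so adding a multiple of the sum of its
  columns to each of the last m columns clears the upper right block. What remains depends on the
  graph only through its order and valency.\<close>

lemma poly_char_poly_join:
  assumes E: "is_graph n E" and reg: "regular n E r" and x: "x \<noteq> \<alpha> * real m + real r"
  shows "poly (char_poly (A_alpha \<alpha> (n + m) (graph_join n E m (complete_graph m)))) x =
    poly (char_poly (A_alpha \<alpha> n E)) (x - \<alpha> * real m) * join_factor n m r \<alpha> x"
proof -
  define c where "c = 1 - \<alpha>"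
  define t where "t = x - \<alpha> * real m - real r"
  have t: "t \<noteq> 0" using x by (simp add: t_def)
  define R where "R = mat n n (\<lambda>(i,j). (if i = j then x - \<alpha> * real m else 0) - A_alpha \<alpha> n E $$ (i,j))"
  define B where "B = mat n m (\<lambda>_. - c)"
  define B' where "B' = mat m n (\<lambda>_. - c)"
  define Y where "Y = mat m m (\<lambda>(i,j). if i = j then x - \<alpha> * real (n + m - 1) else - c)"
  define U where "U = mat n m (\<lambda>_. c / t)"
  define G where "G = graph_join n E m (complete_graph m)"
  have carr: "R \<in> carrier_mat n n" "B \<in> carrier_mat n m" "B' \<in> carrier_mat m n" "Y \<in> carrier_mat m m"
    "U \<in> carrier_mat n m"
    by (auto simp: R_def B_def B'_def Y_def U_def)
  have irr: "\<not> E i i" for i using E unfolding is_graph_def by blast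
  have Gl: "G i j = E i j" if "i < n" "j < n" for i j using that by (auto simp: G_def graph_join_def)
  have Gr: "G i j \<longleftrightarrow> i \<noteq> j" if "n \<le> i \<or> n \<le> j" "i < n + m" "j < n + m" for i j
    using that by (auto simp: G_def graph_join_def complete_graph_def)
  have dl: "degree (n + m) G i = degree n E i + m" if "i < n" for i
    unfolding G_def by (rule degree_join_left[OF that])
  have dr: "degree (n + m) G i = n + m - 1" if "n \<le> i" "i < n + m" for i
    unfolding G_def by (rule degree_join_right[OF that])
  have "mat (n + m) (n + m) (\<lambda>(i,j). (if i = j then x else 0) - A_alpha \<alpha> (n + m) G $$ (i,j)) =
      four_block_mat R B B' Y"
    by (rule eq_matI)
      (auto simp: R_def B_def B'_def Y_def A_alpha_index Gl Gr dl dr irr c_def ring_distribs)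
  hence "poly (char_poly (A_alpha \<alpha> (n + m) G)) x = det (four_block_mat R B B' Y)"
    using poly_char_poly_det[OF A_alpha_carrier[of \<alpha> "n + m" G]] by simp
  also have "\<dots> = det (four_block_mat R B B' Y) * det (four_block_mat (1\<^sub>m n) U (0\<^sub>m m n) (1\<^sub>m m))"
    by (subst det_four_block_mat_lower_left_zero[of "1\<^sub>m n" n U m]) (use carr in auto)
  also have "\<dots> = det (four_block_mat R B B' Y * four_block_mat (1\<^sub>m n) U (0\<^sub>m m n) (1\<^sub>m m))"
    by (rule det_mult[symmetric, of _ "n + m"]) (use carr in auto)
  also have "four_block_mat R B B' Y * four_block_mat (1\<^sub>m n) U (0\<^sub>m m n) (1\<^sub>m m) =
      four_block_mat R (R * U + B) B' (B' * U + Y)"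
    by (subst mult_four_block_mat[of _ n n _ m _ m]) (use carr in auto)
  also have "R * U + B = 0\<^sub>m n m"
  proof (rule eq_matI)
    fix i j assume "i < dim_row (0\<^sub>m n m :: real mat)" "j < dim_col (0\<^sub>m n m :: real mat)"
    hence ij: "i < n" "j < m" by auto
    have "(\<Sum>l = 0..<n. R $$ (i,l)) =
        (\<Sum>l = 0..<n. (if i = l then x - \<alpha> * real m else 0) - A_alpha \<alpha> n E $$ (i,l))"
      using ij by (intro sum.cong refl) (simp add: R_def)
    also have "\<dots> = t"
      unfolding sum_subtractf A_alpha_row_sum[OF ij(1)] using reg ij by (simp add: regular_def t_def)
    finally have row: "(\<Sum>l = 0..<n. R $$ (i,l)) = t" .
    have "(R * U) $$ (i,j) = (\<Sum>l = 0..<n. R $$ (i,l) * (c / t))"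
      using ij carr by (simp add: scalar_prod_def U_def)
    hence "(R * U) $$ (i,j) = t * (c / t)" unfolding sum_distrib_right[symmetric] row .
    thus "(R * U + B) $$ (i,j) = 0\<^sub>m n m $$ (i,j)" using ij t carr by (simp add: B_def)
  qed (use carr in auto)
  also have "det (four_block_mat R (0\<^sub>m n m) B' (B' * U + Y)) = det R * det (B' * U + Y)"
    by (rule det_four_block_mat_upper_right_zero) (use carr in auto)
  also have "det R = poly (char_poly (A_alpha \<alpha> n E)) (x - \<alpha> * real m)"
    unfolding R_def by (rule poly_char_poly_det[OF A_alpha_carrier, symmetric])
  also have "det (B' * U + Y) = join_factor n m r \<alpha> x"
    unfolding join_factor_def c_def[symmetric] t_def[symmetric]
    by (rule arg_cong[of _ _ det], rule eq_matI)
      (use carr in \<open>auto simp: scalar_prod_def B'_def U_def Y_def power2_eq_square\<close>)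
  finally show ?thesis unfolding G_def .
qed

lemma poly_eqI_cofinite:
  fixes p q :: "real poly"
  assumes "finite S" "\<And>x. x \<notin> S \<Longrightarrow> poly p x = poly q x"
  shows "p = q"
proof (rule ccontr)
  assume "p \<noteq> q"
  hence "finite {x. poly (p - q) x = 0}" by (intro poly_roots_finite) simp
  moreover have "- S \<subseteq> {x. poly (p - q) x = 0}" using assms(2) by auto
  ultimately have "finite (UNIV :: real set)"
    using assms(1) by (metis finite_subset finite_Un Compl_partition)
  thus False using infinite_UNIV_char_0 by blast
qed

text \<open>Both joins have the same factor \<open>join_factor\<close>, so the polynomials can be
  compared away from its pole and, when it has to be cancelled, away from its zeros. These exclude
  only finitely many points.\<close>

lemma join_cospectral_iff:
  assumes E: "is_graph n E" "regular n E r" and F: "is_graph n F" "regular n F r"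
  shows "char_poly (A_alpha \<alpha> (n + m) (graph_join n E m (complete_graph m))) =
      char_poly (A_alpha \<alpha> (n + m) (graph_join n F m (complete_graph m))) \<longleftrightarrow>
    char_poly (A_alpha \<alpha> n E) = char_poly (A_alpha \<alpha> n F)"
    (is "?pE = ?pF \<longleftrightarrow> ?qE = ?qF")
proof
  assume eq: "?qE = ?qF"
  show "?pE = ?pF"
    by (rule poly_eqI_cofinite[of "{\<alpha> * real m + real r}"])
      (simp_all add: poly_char_poly_join[OF E] poly_char_poly_join[OF F] eq)
next
  assume eq: "?pE = ?pF"
  have "?pE \<noteq> 0"
    using degree_monic_char_poly[OF A_alpha_carrier[of \<alpha> "n + m" "graph_join n E m (complete_graph m)"]]
    by auto
  hence fin: "finite {x. poly ?pE x = 0}" by (rule poly_roots_finite)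
  \<comment> \<open>Off the roots of the join's polynomial the factor cannot vanish either. The set
    is shifted because the polynomial of \<open>G\<close> is evaluated at
    \<open>x - \<alpha> m\<close>.\<close>
  define S where "S = (\<lambda>x. x - \<alpha> * real m) ` ({\<alpha> * real m + real r} \<union> {x. poly ?pE x = 0})"
  show "?qE = ?qF"
  proof (rule poly_eqI_cofinite[of S])
    show "finite S" using fin by (simp add: S_def)
    fix y assume y: "y \<notin> S"
    define x where "x = y + \<alpha> * real m"
    have y': "y = x - \<alpha> * real m" by (simp add: x_def)
    have x: "x \<noteq> \<alpha> * real m + real r" and nz: "poly ?pE x \<noteq> 0"
      using y unfolding S_def y' by auto
    have "join_factor n m r \<alpha> x \<noteq> 0" using nz poly_char_poly_join[OF E x] by auto
    moreover have "poly ?qE y * join_factor n m r \<alpha> x = poly ?qF y * join_factor n m r \<alpha> x"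
      unfolding y' using eq poly_char_poly_join[OF E x] poly_char_poly_join[OF F x] by metis
    ultimately show "poly ?qE y = poly ?qF y" by simp
  qed
qed

section \<open>The quadratic form of the complement\<close>

text \<open>The quadratic form of \<open>A_alpha\<close> of the complement: a non-edge contributes
  \<open>\<alpha> (a\<^sup>2 + b\<^sup>2) + 2 (1 - \<alpha>) a b\<close>, here rewritten so that
  both coefficients are positive for 1/2 < \<alpha> < 1. Ordered pairs count each non-edge twice,
  hence the division by 2.\<close>

definition complement_form :: "real \<Rightarrow> nat \<Rightarrow> (nat \<Rightarrow> nat \<Rightarrow> bool) \<Rightarrow> real vec \<Rightarrow> real" where
  "complement_form \<alpha> n E x = (\<Sum>i = 0..<n. \<Sum>j = 0..<n. if i \<noteq> j \<and> \<not> E i j then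
     (1 - \<alpha>) * (x $ i + x $ j)\<^sup>2 + (2 * \<alpha> - 1) * ((x $ i)\<^sup>2 + (x $ j)\<^sup>2) else 0) / 2"

lemma complement_form_nonneg:
  assumes "1/2 < \<alpha>" "\<alpha> < 1"
  shows "0 \<le> complement_form \<alpha> n E x"
  unfolding complement_form_def using assms by (auto intro!: sum_nonneg)

text \<open>All summands are nonnegative, so each is 0, while a non-edge at \<open>i\<close> would
  contribute at least \<open>(2 * \<alpha> - 1) * (x $ i)\<^sup>2\<close>. Thus zeros of the form
  live on dominating vertices.\<close>

lemma complement_form_eq_0:
  assumes \<alpha>: "1/2 < \<alpha>" "\<alpha> < 1" and eq: "complement_form \<alpha> n E x = 0"
    and i: "i < n" and nz: "x $ i \<noteq> 0" and j: "j < n" "j \<noteq> i"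
  shows "E i j"
proof (rule ccontr)
  assume "\<not> E i j"
  define f where "f i j = (if i \<noteq> j \<and> \<not> E i j then
     (1 - \<alpha>) * (x $ i + x $ j)\<^sup>2 + (2 * \<alpha> - 1) * ((x $ i)\<^sup>2 + (x $ j)\<^sup>2) else 0)" for i j
  have nonneg: "0 \<le> f i j" for i j using \<alpha> by (auto simp: f_def)
  have "(\<Sum>i = 0..<n. \<Sum>j = 0..<n. f i j) = 0"
    using eq by (simp add: complement_form_def f_def)
  hence "(\<Sum>j = 0..<n. f i j) = 0"
    using i nonneg by (subst (asm) sum_nonneg_eq_0_iff) (auto intro: sum_nonneg)
  hence "f i j = 0" using j nonneg by (subst (asm) sum_nonneg_eq_0_iff) auto
  moreover have "0 < (2 * \<alpha> - 1) * ((x $ i)\<^sup>2 + (x $ j)\<^sup>2)"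
    using \<alpha> nz by (intro mult_pos_pos) (auto intro: add_pos_nonneg)
  moreover have "0 \<le> (1 - \<alpha>) * (x $ i + x $ j)\<^sup>2" using \<alpha> by simp
  ultimately show False using \<open>\<not> E i j\<close> j by (simp add: f_def)
qed

text \<open>The matrices of a graph and of its complement add up to that of the complete graph,
  which is \<open>\<alpha> n - 1\<close> times the identity plus \<open>1 - \<alpha>\<close> times
  the all-ones matrix.\<close>

lemma A_alpha_quadratic_form:
  assumes E: "is_graph n E" and x: "x \<in> carrier_vec n"
  shows "x \<bullet> (A_alpha \<alpha> n E *\<^sub>v x) =
    (\<alpha> * real n - 1) * (x \<bullet> x) + (1 - \<alpha>) * (vec n (\<lambda>_. 1) \<bullet> x)\<^sup>2 - complement_form \<alpha> n E x"
proof -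
  have irr: "\<not> E i i" and symE: "E i j = E j i" for i j using E unfolding is_graph_def by blast+
  \<comment> \<open>The share of the pair \<open>i\<close>, \<open>j\<close> that is booked in row
    \<open>i\<close>: it carries the square of \<open>x $ i\<close> only, so that summing over the
    neighbours yields the degree term.\<close>
  define h where "h i j = \<alpha> * (x $ i)\<^sup>2 + (1 - \<alpha>) * (x $ i * x $ j)" for i j
  define S where "S = (\<Sum>i = 0..<n. \<Sum>j = 0..<n. if i \<noteq> j \<and> \<not> E i j then h i j else 0)"
  have "(A_alpha \<alpha> n E *\<^sub>v x) $ i * x $ i = (\<Sum>j = 0..<n. if E i j then h i j else 0)" if i: "i < n" for i
  proof -
    have "(A_alpha \<alpha> n E *\<^sub>v x) $ i * x $ i = (\<Sum>j = 0..<n. A_alpha \<alpha> n E $$ (i,j) * x $ j * x $ i)"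
      using i x by (simp add: scalar_prod_def sum_distrib_right)
    also have "\<dots> = (\<Sum>j = 0..<n. (if i = j then \<alpha> * real (degree n E i) * (x $ i)\<^sup>2 else 0)
        + (if E i j then (1 - \<alpha>) * (x $ i * x $ j) else 0))"
      using i irr by (intro sum.cong refl) (auto simp: A_alpha_index power2_eq_square)
    also have "\<dots> = \<alpha> * (x $ i)\<^sup>2 * real (degree n E i)
        + (\<Sum>j = 0..<n. if E i j then (1 - \<alpha>) * (x $ i * x $ j) else 0)"
      using i by (simp add: sum.distrib)
    also have "\<dots> = (\<Sum>j = 0..<n. \<alpha> * (x $ i)\<^sup>2 * (if E i j then 1 else 0)
        + (if E i j then (1 - \<alpha>) * (x $ i * x $ j) else 0))"
      unfolding sum.distrib sum_distrib_left[symmetric] sum_adjacency ..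
    also have "\<dots> = (\<Sum>j = 0..<n. if E i j then h i j else 0)"
      by (intro sum.cong refl) (simp add: h_def)
    finally show ?thesis .
  qed
  hence "x \<bullet> (A_alpha \<alpha> n E *\<^sub>v x) = (\<Sum>i = 0..<n. \<Sum>j = 0..<n. if E i j then h i j else 0)"
    by (simp add: scalar_prod_def mult.commute)
  hence "x \<bullet> (A_alpha \<alpha> n E *\<^sub>v x) + S =
      (\<Sum>i = 0..<n. \<Sum>j = 0..<n. (if E i j then h i j else 0) + (if i \<noteq> j \<and> \<not> E i j then h i j else 0))"
    by (simp add: S_def sum.distrib)
  also have "\<dots> = (\<Sum>i = 0..<n. \<Sum>j = 0..<n. h i j - (if i = j then h i i else 0))"
    using irr by (intro sum.cong refl) auto
  also have "\<dots> = (\<Sum>i = 0..<n. \<Sum>j = 0..<n. h i j) - (\<Sum>i = 0..<n. h i i)"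
    by (simp add: sum_subtractf)
  also have "(\<Sum>i = 0..<n. \<Sum>j = 0..<n. h i j) =
      \<alpha> * real n * (\<Sum>i = 0..<n. (x $ i)\<^sup>2) + (1 - \<alpha>) * ((\<Sum>i = 0..<n. x $ i) * (\<Sum>j = 0..<n. x $ j))"
    unfolding sum_product by (simp add: h_def sum.distrib sum_distrib_left mult_ac)
  also have "(\<Sum>i = 0..<n. h i i) = (\<Sum>i = 0..<n. (x $ i)\<^sup>2)"
    by (intro sum.cong refl) (simp add: h_def power2_eq_square algebra_simps)
  finally have 1: "x \<bullet> (A_alpha \<alpha> n E *\<^sub>v x) + S =
      (\<alpha> * real n - 1) * (\<Sum>i = 0..<n. (x $ i)\<^sup>2) + (1 - \<alpha>) * (\<Sum>i = 0..<n. x $ i)\<^sup>2"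
    by (simp add: power2_eq_square algebra_simps)
  \<comment> \<open>Averaging \<open>S\<close> with its transposed copy replaces the one-sided share
    by the symmetric summand of \<open>complement_form\<close>.\<close>
  have swap: "S = (\<Sum>i = 0..<n. \<Sum>j = 0..<n. if i \<noteq> j \<and> \<not> E i j then h j i else 0)"
    unfolding S_def by (subst sum.swap) (intro sum.cong refl, auto simp: symE)
  have "2 * complement_form \<alpha> n E x = (\<Sum>i = 0..<n. \<Sum>j = 0..<n.
      (if i \<noteq> j \<and> \<not> E i j then h i j else 0) + (if i \<noteq> j \<and> \<not> E i j then h j i else 0))"
    unfolding complement_form_def
    by (simp, intro sum.cong refl) (auto simp: h_def power2_eq_square algebra_simps)
  also have "\<dots> = S + S" unfolding sum.distrib swap[symmetric] unfolding S_def ..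
  finally have "complement_form \<alpha> n E x = S" by simp
  moreover have "x \<bullet> x = (\<Sum>i = 0..<n. (x $ i)\<^sup>2)" "vec n (\<lambda>_. 1) \<bullet> x = (\<Sum>i = 0..<n. x $ i)"
    using x by (auto simp: scalar_prod_def power2_eq_square)
  ultimately show ?thesis using 1 by simp
qed

text \<open>The matrix of the complement minus (1 - \<alpha>) times the all-ones matrix.\<close>

definition shifted_mat :: "real \<Rightarrow> nat \<Rightarrow> (nat \<Rightarrow> nat \<Rightarrow> bool) \<Rightarrow> real mat" where
  "shifted_mat \<alpha> n E = (\<alpha> * real n - 1) \<cdot>\<^sub>m 1\<^sub>m n - A_alpha \<alpha> n E"

lemma shifted_mat_carrier [simp]: "shifted_mat \<alpha> n E \<in> carrier_mat n n"
  by (simp add: shifted_mat_def minus_carrier_mat)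

lemma shifted_mat_dim [simp]: "dim_row (shifted_mat \<alpha> n E) = n" "dim_col (shifted_mat \<alpha> n E) = n"
  using shifted_mat_carrier[of \<alpha> n E] by (blast dest: carrier_matD)+

lemma shifted_mat_index:
  assumes "i < n" "j < n"
  shows "shifted_mat \<alpha> n E $$ (i,j) = (if i = j then \<alpha> * real n - 1 else 0) - A_alpha \<alpha> n E $$ (i,j)"
  using assms by (simp add: shifted_mat_def)

lemma shifted_mat_symmetric:
  assumes "is_graph n E"
  shows "(shifted_mat \<alpha> n E)\<^sup>T = shifted_mat \<alpha> n E"
proof (rule eq_matI)
  fix i j assume "i < dim_row (shifted_mat \<alpha> n E)" "j < dim_col (shifted_mat \<alpha> n E)"
  thus "(shifted_mat \<alpha> n E)\<^sup>T $$ (i,j) = shifted_mat \<alpha> n E $$ (i,j)"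
    using arg_cong[OF A_alpha_symmetric[OF assms, of \<alpha>], of "\<lambda>X. X $$ (i,j)"]
    by (simp add: shifted_mat_index)
qed auto

lemma shifted_mat_mult_vec:
  assumes "x \<in> carrier_vec n"
  shows "shifted_mat \<alpha> n E *\<^sub>v x = (\<alpha> * real n - 1) \<cdot>\<^sub>v x - A_alpha \<alpha> n E *\<^sub>v x"
proof -
  have "((\<alpha> * real n - 1) \<cdot>\<^sub>m 1\<^sub>m n) *\<^sub>v x = (\<alpha> * real n - 1) \<cdot>\<^sub>v x"
    using assms by (intro eq_vecI) auto
  thus ?thesis using assms unfolding shifted_mat_def by (simp add: minus_mult_distrib_mat_vec[of _ n n])
qed

lemma shifted_mat_quadratic_form:
  assumes "is_graph n E" "x \<in> carrier_vec n"
  shows "x \<bullet> (shifted_mat \<alpha> n E *\<^sub>v x) =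
    complement_form \<alpha> n E x - (1 - \<alpha>) * (vec n (\<lambda>_. 1) \<bullet> x)\<^sup>2"
proof -
  have "A_alpha \<alpha> n E *\<^sub>v x \<in> carrier_vec n" using assms by (intro mult_mat_vec_carrier[of _ n n]) auto
  thus ?thesis
    unfolding shifted_mat_mult_vec[OF assms(2)]
    using assms A_alpha_quadratic_form[OF assms, of \<alpha>] by (simp add: scalar_prod_minus_distrib[of _ n])
qed

lemma shifted_mat_mult_ones:
  "shifted_mat \<alpha> n E *\<^sub>v vec n (\<lambda>_. 1) = vec n (\<lambda>i. \<alpha> * real n - 1 - real (degree n E i))"
proof (rule eq_vecI)
  fix i assume "i < dim_vec (vec n (\<lambda>i. \<alpha> * real n - 1 - real (degree n E i)))"
  hence i: "i < n" by simp
  have "(shifted_mat \<alpha> n E *\<^sub>v vec n (\<lambda>_. 1)) $ i =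
      (\<Sum>j = 0..<n. (if i = j then \<alpha> * real n - 1 else 0) - A_alpha \<alpha> n E $$ (i,j))"
    using i by (auto simp: scalar_prod_def shifted_mat_index intro!: sum.cong)
  also have "\<dots> = \<alpha> * real n - 1 - real (degree n E i)"
    unfolding sum_subtractf A_alpha_row_sum[OF i] using i by simp
  finally show "(shifted_mat \<alpha> n E *\<^sub>v vec n (\<lambda>_. 1)) $ i =
    vec n (\<lambda>i. \<alpha> * real n - 1 - real (degree n E i)) $ i" using i by simp
qed auto

section \<open>Dominating vertices\<close>

definition dominating :: "nat \<Rightarrow> (nat \<Rightarrow> nat \<Rightarrow> bool) \<Rightarrow> nat set" where
  "dominating n E = {v. v < n \<and> (\<forall>u<n. u \<noteq> v \<longrightarrow> E v u)}"

lemma degree_dominating: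
  assumes "is_graph n E" "v \<in> dominating n E"
  shows "degree n E v = n - 1"
proof -
  have "{j. j < n \<and> E v j} = {..<n} - {v}"
    using assms by (auto simp: dominating_def is_graph_def)
  thus ?thesis using assms by (simp add: degree_def dominating_def)
qed

lemma dominating_if_degree:
  assumes "is_graph n E" "v < n" "n - 1 \<le> degree n E v"
  shows "v \<in> dominating n E"
proof -
  have sub: "{j. j < n \<and> E v j} \<subseteq> {..<n} - {v}"
    using assms by (auto simp: is_graph_def)
  have "card ({..<n} - {v}) \<le> card {j. j < n \<and> E v j}"
    using assms(2,3) by (simp add: degree_def)
  hence "{j. j < n \<and> E v j} = {..<n} - {v}" using sub by (intro card_seteq) auto
  thus ?thesis using assms(2) by (auto simp: dominating_def)
qed

text \<open>A dominating vertex is isolated in the complement, so its column is that of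
  \<open>-(1 - \<alpha>)\<close> times the all-ones matrix; on the diagonal,
  \<open>\<alpha> n - 1 - \<alpha> (n - 1)\<close> gives the same value.\<close>

lemma shifted_mat_mult_dominating:
  assumes E: "is_graph n E" and g: "g \<in> carrier_vec n"
    and supp: "\<And>v. v < n \<Longrightarrow> v \<notin> dominating n E \<Longrightarrow> g $ v = 0"
  shows "shifted_mat \<alpha> n E *\<^sub>v g = (- (1 - \<alpha>) * (vec n (\<lambda>_. 1) \<bullet> g)) \<cdot>\<^sub>v vec n (\<lambda>_. 1)"
proof (rule eq_vecI)
  fix i assume "i < dim_vec ((- (1 - \<alpha>) * (vec n (\<lambda>_. 1) \<bullet> g)) \<cdot>\<^sub>v vec n (\<lambda>_. 1 :: real))"
  hence i: "i < n" by simp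
  have irr: "\<not> E i i" and symE: "E i j = E j i" for i j using E unfolding is_graph_def by blast+
  have entry: "shifted_mat \<alpha> n E $$ (i,v) = - (1 - \<alpha>)" if v: "v \<in> dominating n E" for v
  proof -
    have vn: "v < n" and adj: "i \<noteq> v \<Longrightarrow> E i v" using v i symE by (auto simp: dominating_def)
    have "real (degree n E v) = real n - 1" using degree_dominating[OF E v] vn by simp
    thus ?thesis using i vn adj irr by (auto simp: shifted_mat_index A_alpha_index right_diff_distrib)
  qed
  have "(shifted_mat \<alpha> n E *\<^sub>v g) $ i = (\<Sum>v = 0..<n. shifted_mat \<alpha> n E $$ (i,v) * g $ v)"
    using i g by (simp add: scalar_prod_def)
  also have "\<dots> = (\<Sum>v = 0..<n. - (1 - \<alpha>) * g $ v)"
    using entry supp by (intro sum.cong refl) (metis atLeastLessThan_iff mult_zero_right)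
  also have "\<dots> = - (1 - \<alpha>) * (vec n (\<lambda>_. 1) \<bullet> g)"
    using g by (simp add: scalar_prod_def sum_distrib_left)
  finally show "(shifted_mat \<alpha> n E *\<^sub>v g) $ i =
    ((- (1 - \<alpha>) * (vec n (\<lambda>_. 1) \<bullet> g)) \<cdot>\<^sub>v vec n (\<lambda>_. 1)) $ i" using i by simp
qed auto

section \<open>Symmetric matrices that are nonnegative on a hyperplane\<close>

text \<open>A form that is nonnegative on a hyperplane leaves room for one negative direction, taken
  by \<open>x\<close>. The combination \<open>w\<close> of the orthogonal vectors \<open>x\<close>
  and \<open>u\<close> lies in the hyperplane, and its form value is negative unless the coefficient
  \<open>v \<bullet> u\<close> of \<open>x\<close> is 0.\<close>

lemma nonpos_eigenvector_in_hyperplane: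
  fixes M :: "real mat"
  assumes M: "M \<in> carrier_mat n n" "M\<^sup>T = M" and v: "v \<in> carrier_vec n"
    and nonneg: "\<And>w. w \<in> carrier_vec n \<Longrightarrow> v \<bullet> w = 0 \<Longrightarrow> 0 \<le> w \<bullet> (M *\<^sub>v w)"
    and x: "x \<in> carrier_vec n" "x \<noteq> 0\<^sub>v n" "M *\<^sub>v x = a \<cdot>\<^sub>v x"
    and u: "u \<in> carrier_vec n" "M *\<^sub>v u = b \<cdot>\<^sub>v u"
    and ab: "a < b" "b \<le> 0"
  shows "v \<bullet> u = 0"
proof -
  have "(M *\<^sub>v x) \<bullet> u = x \<bullet> (M *\<^sub>v u)" by (rule symmetric_mat_scalar_prod[OF M x(1) u(1)])
  hence "a * (x \<bullet> u) = b * (x \<bullet> u)" unfolding x(3) u(2) using x(1) u(1) by simp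
  hence xu: "x \<bullet> u = 0" using ab by simp
  hence ux: "u \<bullet> x = 0" using comm_scalar_prod[OF x(1) u(1)] by simp
  define p where "p = v \<bullet> u"
  define q where "q = v \<bullet> x"
  define w where "w = p \<cdot>\<^sub>v x - q \<cdot>\<^sub>v u"
  have w: "w \<in> carrier_vec n" using x u by (simp add: w_def)
  have "v \<bullet> w = 0"
    unfolding w_def using v x(1) u(1) by (simp add: scalar_prod_minus_distrib[of _ n] p_def q_def)
  hence "0 \<le> w \<bullet> (M *\<^sub>v w)" by (rule nonneg[OF w])
  also have "M *\<^sub>v w = (p * a) \<cdot>\<^sub>v x - (q * b) \<cdot>\<^sub>v u"
    unfolding w_def using M x u
    by (simp add: mult_minus_distrib_mat_vec[of _ n n] mult_mat_vec[of _ n n] smult_smult_assoc)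
  also have "w \<bullet> \<dots> = p\<^sup>2 * a * (x \<bullet> x) + q\<^sup>2 * b * (u \<bullet> u)"
    unfolding w_def using x(1) u(1)
    by (simp add: scalar_prod_minus_distrib[of _ n] minus_scalar_prod_distrib[of _ n] xu ux power2_eq_square)
  finally have ge: "0 \<le> p\<^sup>2 * a * (x \<bullet> x) + q\<^sup>2 * b * (u \<bullet> u)" .
  have "0 \<le> u \<bullet> u" using scalar_prod_self_pos[OF u(1)] u(1) by (cases "u = 0\<^sub>v n") auto
  hence "q\<^sup>2 * b * (u \<bullet> u) \<le> 0" using ab by (simp add: mult_nonneg_nonpos mult_nonpos_nonneg)
  hence "0 \<le> p\<^sup>2 * (a * (x \<bullet> x))" using ge by (simp add: mult.assoc)
  moreover have "a * (x \<bullet> x) < 0" using ab scalar_prod_self_pos[OF x(1,2)] by (simp add: mult_neg_pos)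
  ultimately have "p\<^sup>2 \<le> 0" by (meson not_le mult_pos_neg)
  thus ?thesis by (simp add: p_def)
qed

text \<open>Here \<open>z\<close> is the preimage of \<open>v\<close>. The lower bound is Gauss quadrature: the moments of the
  spectral measure of \<open>v\<close> up to order two are those of a measure on \<open>{a, b}\<close>, and the quadratic
  that interpolates \<open>1/y\<close> at \<open>a\<close> and, doubly, at \<open>b\<close> lies below \<open>1/y\<close> on the spectrum. It is
  obtained by applying the gap inequality to the vector \<open>v - b z\<close>.\<close>

lemma inverse_moment_bounds:
  fixes M :: "real mat"
  assumes M: "M \<in> carrier_mat n n" "M\<^sup>T = M" and v: "v \<in> carrier_vec n"
    and nonneg: "\<And>w. w \<in> carrier_vec n \<Longrightarrow> v \<bullet> w = 0 \<Longrightarrow> 0 \<le> w \<bullet> (M *\<^sub>v w)"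
    and x: "x \<in> carrier_vec n" "x \<noteq> 0\<^sub>v n" "M *\<^sub>v x = a \<cdot>\<^sub>v x"
    and ab: "a < 0" "0 < b"
    and z: "z \<in> carrier_vec n" "M *\<^sub>v z = v"
    and moments: "(M *\<^sub>v v) \<bullet> (M *\<^sub>v v) - 2 * b * (v \<bullet> (M *\<^sub>v v)) + b\<^sup>2 * (v \<bullet> v)
      - a * (v \<bullet> (M *\<^sub>v v) - 2 * b * (v \<bullet> v) + b\<^sup>2 * t) = 0"
  shows "t \<le> v \<bullet> z" and "v \<bullet> z \<le> 0"
proof -
  define \<tau> where "\<tau> = v \<bullet> z"
  have Mo: "M *\<^sub>v v \<in> carrier_vec n" using M v by simp
  have zo: "z \<bullet> v = \<tau>" unfolding \<tau>_def by (rule comm_scalar_prod[OF z(1) v])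
  show "v \<bullet> z \<le> 0"
  proof (rule ccontr)
    assume "\<not> v \<bullet> z \<le> 0"
    hence pos: "0 < \<tau>" by (simp add: \<tau>_def)
    define q where "q = v \<bullet> x"
    have xo: "x \<bullet> v = q" unfolding q_def by (rule comm_scalar_prod[OF x(1) v])
    have "(M *\<^sub>v z) \<bullet> x = z \<bullet> (M *\<^sub>v x)" by (rule symmetric_mat_scalar_prod[OF M z(1) x(1)])
    hence zx: "a * (z \<bullet> x) = q" unfolding z(2) x(3) q_def using z(1) x(1) by simp
    \<comment> \<open>As \<open>M *\<^sub>v z = v\<close>, the vector \<open>z\<close> is orthogonal
      to the hyperplane with respect to \<open>M\<close>, and its form value is \<tau>. With \<tau>
      > 0 the form would be nonnegative everywhere; projecting \<open>x\<close> along
      \<open>z\<close> into the hyperplane shows the contradiction.\<close>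
    define w where "w = x - (q / \<tau>) \<cdot>\<^sub>v z"
    have w: "w \<in> carrier_vec n" using x z by (simp add: w_def)
    have "v \<bullet> w = 0"
      unfolding w_def using v x(1) z(1) pos
      by (simp add: scalar_prod_minus_distrib[of _ n] q_def \<tau>_def[symmetric])
    hence "0 \<le> w \<bullet> (M *\<^sub>v w)" by (rule nonneg[OF w])
    also have "M *\<^sub>v w = a \<cdot>\<^sub>v x - (q / \<tau>) \<cdot>\<^sub>v v"
      unfolding w_def using M x z
      by (simp add: mult_minus_distrib_mat_vec[of _ n n] mult_mat_vec[of _ n n])
    also have "w \<bullet> \<dots> = a * (x \<bullet> x) - (q / \<tau>) * (a * (z \<bullet> x)) - (q / \<tau>) * q + (q / \<tau>) * (q / \<tau>) * \<tau>"
      unfolding w_def using x(1) z(1) v xo zo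
      by (simp add: scalar_prod_minus_distrib[of _ n] minus_scalar_prod_distrib[of _ n] algebra_simps)
    also have "\<dots> = a * (x \<bullet> x) - q\<^sup>2 / \<tau>"
      unfolding zx using pos by (simp add: field_simps power2_eq_square)
    finally have "0 \<le> a * (x \<bullet> x) - q\<^sup>2 / \<tau>" .
    moreover have "a * (x \<bullet> x) < 0" using ab scalar_prod_self_pos[OF x(1,2)] by (simp add: mult_neg_pos)
    moreover have "0 \<le> q\<^sup>2 / \<tau>" using pos by simp
    ultimately show False by linarith
  qed
  \<comment> \<open>No eigenvalue lies strictly between \<open>a\<close> and 0: its eigenvector
    would lie in the hyperplane and have a negative form value.\<close>
  have gap: "0 \<le> e * (e - a)" if "eigenvalue M e" for e
  proof (rule ccontr)
    assume "\<not> 0 \<le> e * (e - a)"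
    hence e: "a < e" "e < 0" using ab by (auto simp: zero_le_mult_iff not_le)
    obtain u where u: "u \<in> carrier_vec n" "u \<noteq> 0\<^sub>v n" "M *\<^sub>v u = e \<cdot>\<^sub>v u"
      using \<open>eigenvalue M e\<close> M unfolding eigenvalue_def eigenvector_def by auto
    have "v \<bullet> u = 0"
      by (rule nonpos_eigenvector_in_hyperplane[OF M v nonneg x u(1,3)]) (use e in auto)
    hence "0 \<le> u \<bullet> (M *\<^sub>v u)" by (rule nonneg[OF u(1)])
    hence "0 \<le> e * (u \<bullet> u)" unfolding u(3) using u(1) by simp
    thus False using e scalar_prod_self_pos[OF u(1,2)] by (simp add: zero_le_mult_iff)
  qed
  define g where "g = v - b \<cdot>\<^sub>v z"
  have g: "g \<in> carrier_vec n" using v z by (simp add: g_def)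
  have Mg: "M *\<^sub>v g = M *\<^sub>v v - b \<cdot>\<^sub>v v"
    unfolding g_def using M v z by (simp add: mult_minus_distrib_mat_vec[of _ n n] mult_mat_vec[of _ n n])
  have zMo: "z \<bullet> (M *\<^sub>v v) = v \<bullet> v"
    using symmetric_mat_scalar_prod[OF M z(1) v] z(2) by simp
  have Moo: "(M *\<^sub>v v) \<bullet> v = v \<bullet> (M *\<^sub>v v)" by (rule comm_scalar_prod[OF Mo v])
  have 1: "(M *\<^sub>v g) \<bullet> (M *\<^sub>v g) =
      (M *\<^sub>v v) \<bullet> (M *\<^sub>v v) - 2 * b * (v \<bullet> (M *\<^sub>v v)) + b\<^sup>2 * (v \<bullet> v)"
    unfolding Mg using Mo v
    by (simp add: scalar_prod_minus_distrib[of _ n] minus_scalar_prod_distrib[of _ n] Moo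
        power2_eq_square algebra_simps)
  have 2: "g \<bullet> (M *\<^sub>v g) = v \<bullet> (M *\<^sub>v v) - 2 * b * (v \<bullet> v) + b\<^sup>2 * \<tau>"
    unfolding Mg unfolding g_def using Mo v z(1)
    by (simp add: scalar_prod_minus_distrib[of _ n] minus_scalar_prod_distrib[of _ n] zMo zo
        power2_eq_square algebra_simps)
  have "0 \<le> (M *\<^sub>v g) \<bullet> (M *\<^sub>v g) - a * (g \<bullet> (M *\<^sub>v g))"
    by (rule quadratic_form_nonneg_if_spectral_gap[OF M gap g])
  \<comment> \<open>The expression differs from the left-hand side of \<open>moments\<close> only in
    having \<tau> in place of \<open>t\<close>.\<close>
  hence "0 \<le> (- a * b\<^sup>2) * (\<tau> - t)" unfolding 1 2 using moments by (simp add: algebra_simps)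
  moreover have "0 < - a * b\<^sup>2" using ab by (simp add: mult_neg_pos)
  ultimately have "0 \<le> \<tau> - t" by (meson not_le mult_pos_neg)
  thus "t \<le> v \<bullet> z" by (simp add: \<tau>_def)
qed

section \<open>Dominating vertices of cospectral mates\<close>

text \<open>The system is padded with zero rows to a square matrix. Row \<open>k\<close> is then 0,
  so the transpose kills a unit vector and the determinant vanishes.\<close>

lemma homogeneous_system_nontrivial:
  fixes a :: "nat \<Rightarrow> nat \<Rightarrow> real"
  assumes "k < m"
  shows "\<exists>g \<in> carrier_vec m. g \<noteq> 0\<^sub>v m \<and> (\<forall>i<k. (\<Sum>j = 0..<m. a i j * g $ j) = 0)"
proof -
  define A where "A = mat m m (\<lambda>(i,j). if i < k then a i j else 0)"
  have A: "A \<in> carrier_mat m m" by (simp add: A_def)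
  have "A\<^sup>T *\<^sub>v unit_vec m k = 0\<^sub>v m"
    using assms by (intro eq_vecI) (auto simp: A_def)
  moreover have "unit_vec m k \<noteq> (0\<^sub>v m :: real vec)" using assms by simp
  ultimately have "det A\<^sup>T = 0"
    using det_0_iff_vec_prod_zero[of "A\<^sup>T" m] A unit_vec_carrier by (metis transpose_carrier_mat)
  hence "det A = 0" using det_transpose[OF A] by simp
  then obtain g where g: "g \<in> carrier_vec m" "g \<noteq> 0\<^sub>v m" "A *\<^sub>v g = 0\<^sub>v m"
    using det_0_iff_vec_prod_zero[OF A] by blast
  have "(\<Sum>j = 0..<m. a i j * g $ j) = 0" if "i < k" for i
  proof -
    have "(A *\<^sub>v g) $ i = (\<Sum>j = 0..<m. a i j * g $ j)"
      using that assms g(1) by (simp add: A_def scalar_prod_def)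
    thus ?thesis using g(3) that assms by simp
  qed
  thus ?thesis using g by blast
qed

lemma solvable_if_det_nonzero:
  fixes M :: "real mat"
  assumes M: "M \<in> carrier_mat n n" "det M \<noteq> 0" and b: "b \<in> carrier_vec n"
  shows "\<exists>z \<in> carrier_vec n. M *\<^sub>v z = b"
proof -
  note adj = Determinant.adj_mat[OF M(1)]
  define z where "z = Determinant.adj_mat M *\<^sub>v ((1 / det M) \<cdot>\<^sub>v b)"
  have z: "z \<in> carrier_vec n" using adj(1) b by (simp add: z_def)
  have "M *\<^sub>v z = (det M \<cdot>\<^sub>m 1\<^sub>m n) *\<^sub>v ((1 / det M) \<cdot>\<^sub>v b)"
    unfolding z_def adj(2)[symmetric] using M(1) adj(1) b by (simp add: assoc_mult_mat_vec[of _ n n _ n])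
  also have "\<dots> = b" using M(2) b by (intro eq_vecI) auto
  finally show ?thesis using z by blast
qed

lemma shifted_mat_conjugate:
  assumes P: "P \<in> carrier_mat n n" "P\<^sup>T * P = 1\<^sub>m n" and A: "A_alpha \<alpha> n E = P\<^sup>T * A_alpha \<alpha> n F * P"
  shows "shifted_mat \<alpha> n E = P\<^sup>T * shifted_mat \<alpha> n F * P"
proof -
  define l where "l = \<alpha> * real n - 1"
  define B where "B = A_alpha \<alpha> n F"
  have B: "B \<in> carrier_mat n n" by (simp add: B_def)
  have PT: "P\<^sup>T \<in> carrier_mat n n" using P by simp
  have "P\<^sup>T * (l \<cdot>\<^sub>m 1\<^sub>m n - B) = l \<cdot>\<^sub>m P\<^sup>T - P\<^sup>T * B"
    using PT B by (simp add: mult_minus_distrib_mat[of _ n n _ n] mult_smult_distrib[of _ n n _ n])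
  hence "P\<^sup>T * (l \<cdot>\<^sub>m 1\<^sub>m n - B) * P = l \<cdot>\<^sub>m (P\<^sup>T * P) - P\<^sup>T * B * P"
    using PT B P(1) by (simp add: minus_mult_distrib_mat[of _ n n _ _ n] mult_smult_assoc_mat[of _ n n _ n])
  thus ?thesis unfolding shifted_mat_def A P(2) by (simp add: l_def B_def)
qed

lemma eigenvector_conjugate:
  fixes B P :: "real mat"
  assumes P: "P \<in> carrier_mat n n" "P * P\<^sup>T = 1\<^sub>m n" and B: "B \<in> carrier_mat n n"
    and x: "x \<in> carrier_vec n" "B *\<^sub>v x = a \<cdot>\<^sub>v x"
  shows "(P\<^sup>T * B * P) *\<^sub>v (P\<^sup>T *\<^sub>v x) = a \<cdot>\<^sub>v (P\<^sup>T *\<^sub>v x)"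
    and "P *\<^sub>v (P\<^sup>T *\<^sub>v x) = x"
proof -
  show 1: "P *\<^sub>v (P\<^sup>T *\<^sub>v x) = x"
    using assoc_mult_mat_vec[of P n n "P\<^sup>T" n x] P x(1) by simp
  have "(P\<^sup>T * B * P) *\<^sub>v (P\<^sup>T *\<^sub>v x) = P\<^sup>T *\<^sub>v (B *\<^sub>v (P *\<^sub>v (P\<^sup>T *\<^sub>v x)))"
    using P(1) B x(1) by (simp add: assoc_mult_mat_vec[of _ n n _ n])
  thus "(P\<^sup>T * B * P) *\<^sub>v (P\<^sup>T *\<^sub>v x) = a \<cdot>\<^sub>v (P\<^sup>T *\<^sub>v x)"
    unfolding 1 x(2) using P(1) x(1) by (simp add: mult_mat_vec[of _ n n])
qed

section \<open>The join and its cospectral mates\<close>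

lemma dominating_join:
  assumes "n \<le> v" "v < n + m"
  shows "v \<in> dominating (n + m) (graph_join n E m (complete_graph m))"
  using assms by (auto simp: dominating_def graph_join_def complete_graph_def)

text \<open>Row sums: the complement of the join is the complement of \<open>E\<close>, regular of
  valency \<open>n - 1 - r\<close>, together with \<open>m\<close> isolated vertices, and
  \<open>1 - \<alpha>\<close> is subtracted from each of the \<open>n + m\<close> entries of a
  row.\<close>

lemma shifted_mat_join_ones:
  assumes "regular n E r" "r \<le> n - 1" "1 \<le> n"
  shows "shifted_mat \<alpha> (n + m) (graph_join n E m (complete_graph m)) *\<^sub>v vec (n + m) (\<lambda>_. 1) =
    vec (n + m) (\<lambda>i. (real (n - 1 - r) - (1 - \<alpha>) * real (n + m))
      - (if n \<le> i then real (n - 1 - r) else 0))"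
proof -
  have "\<alpha> * real (n + m) - 1 - real (degree (n + m) (graph_join n E m (complete_graph m)) i) =
      real (n - 1 - r) - (1 - \<alpha>) * real (n + m) - (if n \<le> i then real (n - 1 - r) else 0)"
    if "i < n + m" for i
  proof (cases "n \<le> i")
    case True
    hence "real (degree (n + m) (graph_join n E m (complete_graph m)) i) = real n + real m - 1"
      using assms(3) that by (simp add: degree_join_right of_nat_diff)
    thus ?thesis using True by (simp add: algebra_simps)
  next
    case False
    hence "degree (n + m) (graph_join n E m (complete_graph m)) i = r + m"
      using assms by (simp add: degree_join_left regular_def)
    thus ?thesis using False assms by (simp add: of_nat_diff algebra_simps)
  qed
  thus ?thesis unfolding shifted_mat_mult_ones by (intro eq_vecI) auto
qed

text \<open>\<open>E\<close> is not complete here, which makes \<open>s\<close> positive and gives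
  the shifted matrix of the join a negative eigenvalue. This eigenvalue and the kernel are carried
  over to \<open>H\<close> by an orthogonal similarity.\<close>

lemma card_dominating_ge:
  assumes E: "is_graph n E" and reg: "regular n E r" and r: "r < n - 1" and m: "1 \<le> m"
    and \<alpha>: "1/2 < \<alpha>" "\<alpha> < 1" and H: "is_graph (n + m) H"
    and cp: "char_poly (A_alpha \<alpha> (n + m) H) =
      char_poly (A_alpha \<alpha> (n + m) (graph_join n E m (complete_graph m)))"
  shows "m \<le> card (dominating (n + m) H)"
proof -
  define N where "N = n + m"
  define K where "K = graph_join n E m (complete_graph m)"
  define c where "c = 1 - \<alpha>"
  define s where "s = real (n - 1 - r)"
  define J where "J = vec N (\<lambda>_. 1 :: real)"
  define \<kappa> where "\<kappa> = vec N (\<lambda>i. if n \<le> i then 1 else 0 :: real)"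
  define L where "L = shifted_mat \<alpha> N K"
  define M where "M = shifted_mat \<alpha> N H"
  define b where "b = s - c * real N"
  \<comment> \<open>\<open>L\<close> preserves the plane spanned by \<open>J\<close> and \<kappa>,
    and \<open>y0\<close>, \<open>y1\<close> are its eigenvalues there: the roots of
    \<open>y\<^sup>2 - b y - c m s\<close>, which have opposite signs.\<close>
  define D where "D = sqrt (b\<^sup>2 + 4 * c * real m * s)"
  define y0 where "y0 = (b - D) / 2"
  define y1 where "y1 = (b + D) / 2"
  have K: "is_graph N K" unfolding N_def K_def by (rule is_graph_join[OF E])
  have H: "is_graph N H" using H by (simp add: N_def)
  have c: "0 < c" and s: "0 < s" using \<alpha> r by (auto simp: c_def s_def)
  have J: "J \<in> carrier_vec N" and \<kappa>: "\<kappa> \<in> carrier_vec N" by (auto simp: J_def \<kappa>_def)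
  have L: "L \<in> carrier_mat N N" and M: "M \<in> carrier_mat N N" "M\<^sup>T = M"
    using shifted_mat_symmetric[OF H] by (auto simp: L_def M_def)

  have cms: "0 < 4 * c * real m * s" using c s m by simp
  have D2: "D\<^sup>2 = b\<^sup>2 + 4 * c * real m * s"
    unfolding D_def using cms by (intro real_sqrt_pow2) (simp add: add_nonneg_nonneg)
  have "\<bar>b\<bar> < D" unfolding D_def using cms by (intro real_less_rsqrt) simp
  hence y: "y0 < 0" "0 < y1" by (auto simp: y0_def y1_def)
  have ysum: "y0 + y1 = b" by (simp add: y0_def y1_def field_simps)
  have "4 * (y0 * y1) = b\<^sup>2 - D\<^sup>2" by (simp add: y0_def y1_def field_simps power2_eq_square)
  hence yprod: "y0 * y1 = - (c * real m * s)" unfolding D2 by simp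

  have LJ: "L *\<^sub>v J = b \<cdot>\<^sub>v J - s \<cdot>\<^sub>v \<kappa>"
    unfolding L_def J_def K_def N_def
    using shifted_mat_join_ones[OF reg, of \<alpha> m] r
    by (intro eq_vecI) (auto simp: b_def s_def c_def \<kappa>_def N_def)
  have dom: "v \<in> dominating N K" if "n \<le> v" "v < N" for v
    unfolding N_def K_def by (rule dominating_join) (use that in \<open>auto simp: N_def\<close>)
  have Ldom: "L *\<^sub>v g = (- c * (J \<bullet> g)) \<cdot>\<^sub>v J" if "g \<in> carrier_vec N" "\<And>v. v < n \<Longrightarrow> g $ v = 0" for g
    unfolding L_def J_def c_def
    by (rule shifted_mat_mult_dominating[OF K that(1)]) (use dom that(2) in \<open>metis not_le\<close>)
  have J\<kappa>: "J \<bullet> \<kappa> = real m"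
  proof -
    have "J \<bullet> \<kappa> = (\<Sum>i = 0..<N. if n \<le> i then 1 else 0)" by (simp add: J_def \<kappa>_def scalar_prod_def)
    also have "\<dots> = real (card ({0..<N} \<inter> {i. n \<le> i}))" by (simp add: sum.If_cases)
    also have "{0..<N} \<inter> {i. n \<le> i} = {n..<N}" by auto
    finally show ?thesis by (simp add: N_def)
  qed
  have L\<kappa>: "L *\<^sub>v \<kappa> = (- c * real m) \<cdot>\<^sub>v J"
    using Ldom[OF \<kappa>] unfolding J\<kappa> by (simp add: \<kappa>_def N_def)
  \<comment> \<open>The eigenvector for \<open>y0\<close> in that plane. It is nonzero because its
    entry at vertex 0, which lies outside the clique, is \<open>y0\<close>.\<close>
  define x0 where "x0 = y0 \<cdot>\<^sub>v J - s \<cdot>\<^sub>v \<kappa>"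
  have x0: "x0 \<in> carrier_vec N" using J \<kappa> by (simp add: x0_def)
  have n0: "0 < n" "0 < N" using r by (auto simp: N_def)
  hence "x0 $ 0 = y0" by (simp add: x0_def J_def \<kappa>_def)
  hence x0nz: "x0 \<noteq> 0\<^sub>v N" using y n0 by auto
  have Lx0: "L *\<^sub>v x0 = y0 \<cdot>\<^sub>v x0"
  proof -
    have "L *\<^sub>v x0 = y0 \<cdot>\<^sub>v (b \<cdot>\<^sub>v J - s \<cdot>\<^sub>v \<kappa>) - s \<cdot>\<^sub>v ((- c * real m) \<cdot>\<^sub>v J)"
      unfolding x0_def LJ[symmetric] L\<kappa>[symmetric] using L J \<kappa>
      by (simp add: mult_minus_distrib_mat_vec[of _ N N] mult_mat_vec[of _ N N])
    also have "\<dots> = y0 \<cdot>\<^sub>v x0"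
    proof (rule eq_vecI)
      fix i assume "i < dim_vec (y0 \<cdot>\<^sub>v x0)"
      hence i: "i < N" using x0 by simp
      have "y0 * (b - s * \<kappa> $ i) + s * c * real m = y0 * (y0 - s * \<kappa> $ i)"
        using yprod unfolding ysum[symmetric] by (simp add: algebra_simps)
      thus "(y0 \<cdot>\<^sub>v (b \<cdot>\<^sub>v J - s \<cdot>\<^sub>v \<kappa>) - s \<cdot>\<^sub>v ((- c * real m) \<cdot>\<^sub>v J)) $ i = (y0 \<cdot>\<^sub>v x0) $ i"
        using i \<kappa> J by (simp add: x0_def J_def)
    qed (use J \<kappa> in \<open>auto simp: x0_def\<close>)
    finally show ?thesis .
  qed

  obtain P where P: "P \<in> carrier_mat N N" "P * P\<^sup>T = 1\<^sub>m N" "P\<^sup>T * P = 1\<^sub>m N"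
    "A_alpha \<alpha> N H = P\<^sup>T * A_alpha \<alpha> N K * P"
    using orthogonally_similar_if_char_poly_eq[OF A_alpha_carrier A_alpha_symmetric[OF H]
        A_alpha_carrier A_alpha_symmetric[OF K], of \<alpha> \<alpha>] cp unfolding N_def K_def by blast
  have MP: "M = P\<^sup>T * L * P" unfolding M_def L_def by (rule shifted_mat_conjugate[OF P(1,3,4)])
  define x where "x = P\<^sup>T *\<^sub>v x0"
  have x: "x \<in> carrier_vec N" using P x0 by (simp add: x_def)
  have Mx: "M *\<^sub>v x = y0 \<cdot>\<^sub>v x" and Px: "P *\<^sub>v x = x0"
    using eigenvector_conjugate[OF P(1,2) L x0 Lx0] by (auto simp: MP x_def)
  have xnz: "x \<noteq> 0\<^sub>v N"
  proof
    assume "x = 0\<^sub>v N"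
    hence "x0 = 0\<^sub>v N" using Px P(1) by (auto simp: mult_mat_vec_def)
    thus False using x0nz by simp
  qed

  define q where "q = complement_form \<alpha> N H"
  have qM: "w \<bullet> (M *\<^sub>v w) = q w - c * (J \<bullet> w)\<^sup>2" if "w \<in> carrier_vec N" for w
    unfolding M_def q_def c_def J_def by (rule shifted_mat_quadratic_form[OF H that])
  have nonneg: "0 \<le> w \<bullet> (M *\<^sub>v w)" if "w \<in> carrier_vec N" "J \<bullet> w = 0" for w
    using qM[OF that(1)] that(2) complement_form_nonneg[OF \<alpha>, of N H w] by (simp add: q_def)
  define I where "I = dominating N H"
  have fin: "finite I" by (simp add: I_def dominating_def)
  have supp: "v \<in> I" if "q w = 0" "v < N" "w $ v \<noteq> 0" for v w
    using complement_form_eq_0[OF \<alpha>, of N H w v] that by (auto simp: q_def I_def dominating_def)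
  \<comment> \<open>The eigenvalue 0 exceeds \<open>y0\<close>, so kernel vectors lie in the
    hyperplane, where \<open>M\<close> has the form \<open>q\<close>. Hence they are supported on
    \<open>I\<close>.\<close>
  have ker: "J \<bullet> u = 0" "q u = 0" if u: "u \<in> carrier_vec N" "M *\<^sub>v u = 0\<^sub>v N" for u
  proof -
    have "M *\<^sub>v u = 0 \<cdot>\<^sub>v u" using u by (intro eq_vecI) auto
    thus Ju: "J \<bullet> u = 0"
      using nonpos_eigenvector_in_hyperplane[OF M J nonneg x xnz Mx u(1)] y by simp
    show "q u = 0" using qM[OF u(1)] unfolding u(2) Ju using u(1) by simp
  qed

  have "m \<le> card I"
  proof (cases "m = 1")
    case True
    \<comment> \<open>For \<open>m = 1\<close> a single dominating vertex suffices, and any vertex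
      in the support of such a \<open>z\<close> is one.\<close>
    have "\<exists>z \<in> carrier_vec N. z \<noteq> 0\<^sub>v N \<and> q z = 0"
    proof (cases "det M = 0")
      case True
      thus ?thesis using det_0_iff_vec_prod_zero[OF M(1)] ker by blast
    next
      case False
      then obtain z where z: "z \<in> carrier_vec N" "M *\<^sub>v z = J"
        using solvable_if_det_nonzero[OF M(1) _ J] by blast
      \<comment> \<open>The moments of \<open>J\<close> of orders one and two depend only on the
        sums of the degrees and of their squares, so they agree for \<open>M\<close> and
        \<open>L\<close> and can be computed from the join.\<close>
      have LJ': "L *\<^sub>v J = vec N (\<lambda>i. \<alpha> * real N - 1 - real (degree N K i))"
        and MJ: "M *\<^sub>v J = vec N (\<lambda>i. \<alpha> * real N - 1 - real (degree N H i))"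
        unfolding L_def M_def J_def by (rule shifted_mat_mult_ones)+
      have "\<alpha> \<noteq> 0" using \<alpha> by simp
      note sums = cospectral_degree_sums[OF H K this cp[folded N_def K_def]]
      have "J \<bullet> (M *\<^sub>v J) = J \<bullet> (L *\<^sub>v J)"
        unfolding LJ' MJ by (simp add: J_def scalar_prod_def sum_subtractf sums)
      also have "\<dots> = b * (J \<bullet> J) - s * real m"
        unfolding LJ using J \<kappa> by (simp add: scalar_prod_minus_distrib[of _ N] J\<kappa>)
      finally have S1: "J \<bullet> (M *\<^sub>v J) = b * real N - s"
        using True by (simp add: J_def scalar_prod_def)
      have sq: "(vec N f) \<bullet> (vec N f) = (\<Sum>i = 0..<N. (f i)\<^sup>2)" for f :: "nat \<Rightarrow> real"
        by (simp add: scalar_prod_def power2_eq_square)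
      have expand: "(\<Sum>i = 0..<N. (l - real (d i))\<^sup>2) =
          real N * l\<^sup>2 - 2 * l * (\<Sum>i = 0..<N. real (d i)) + (\<Sum>i = 0..<N. (real (d i))\<^sup>2)"
        for l and d :: "nat \<Rightarrow> nat"
        by (simp add: power2_diff sum.distrib sum_subtractf sum_distrib_left mult.assoc)
      have "(M *\<^sub>v J) \<bullet> (M *\<^sub>v J) = (L *\<^sub>v J) \<bullet> (L *\<^sub>v J)"
        unfolding LJ' MJ sq expand sums ..
      also have "\<dots> = b\<^sup>2 * (J \<bullet> J) - 2 * b * s * (J \<bullet> \<kappa>) + s\<^sup>2 * (\<kappa> \<bullet> \<kappa>)"
        unfolding LJ using J \<kappa> comm_scalar_prod[OF \<kappa> J]
        by (simp add: scalar_prod_minus_distrib[of _ N] minus_scalar_prod_distrib[of _ N]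
            power2_eq_square algebra_simps)
      also have "\<kappa> \<bullet> \<kappa> = J \<bullet> \<kappa>" unfolding scalar_prod_def by (intro sum.cong) (auto simp: \<kappa>_def J_def)
      finally have S2: "(M *\<^sub>v J) \<bullet> (M *\<^sub>v J) = b\<^sup>2 * real N - 2 * b * s + s\<^sup>2"
        unfolding J\<kappa> using True by (simp add: J_def scalar_prod_def)
      have S0: "J \<bullet> J = real N" by (simp add: J_def scalar_prod_def)
      \<comment> \<open>The number \<open>- 1 / c\<close> is the inverse moment of the join, where
        \<open>L\<close> maps \<open>-\<kappa> / c\<close> to \<open>J\<close>. The identity says
        that \<open>(y - y0) (y - y1)\<^sup>2 / y\<close> has integral 0 for the spectral measure of
        \<open>J\<close> under \<open>L\<close>, which lives on \<open>y0\<close> and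
        \<open>y1\<close>.\<close>
      have "(b\<^sup>2 * real N - 2 * b * s + s\<^sup>2) - 2 * y1 * (b * real N - s) + y1\<^sup>2 * real N
          - y0 * (b * real N - s - 2 * y1 * real N + y1\<^sup>2 * (- 1 / c)) = 0"
      proof -
        have cs: "c * s = - (y0 * y1)" using yprod True by simp
        have "c * ((b\<^sup>2 * real N - 2 * b * s + s\<^sup>2) - 2 * y1 * (b * real N - s) + y1\<^sup>2 * real N
            - y0 * (b * real N - s - 2 * y1 * real N + y1\<^sup>2 * (- 1 / c))) =
          c * real N * (y0 * y1) + (c * s) * (s - y0) + y0 * y1 * y1"
          unfolding ysum[symmetric] using c by (simp add: field_simps power2_eq_square)
        also have "\<dots> = (y0 * y1) * (c * real N - s + (y0 + y1))"
          unfolding cs by (simp add: algebra_simps)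
        also have "\<dots> = 0" unfolding ysum b_def by simp
        finally show ?thesis using c by simp
      qed
      hence "- 1 / c \<le> J \<bullet> z" "J \<bullet> z \<le> 0"
        using inverse_moment_bounds[OF M J nonneg x xnz Mx y z, of "- 1 / c"]
        unfolding S0 S1 S2 by auto
      hence bounds: "0 \<le> 1 + c * (J \<bullet> z)" "J \<bullet> z \<le> 0" using c by (auto simp: field_simps)
      have "z \<bullet> (M *\<^sub>v z) = J \<bullet> z" unfolding z(2) by (rule comm_scalar_prod[OF z(1) J])
      \<comment> \<open>The bounds place \<open>J \<bullet> z\<close> between the two roots
        \<open>- 1 / c\<close> and 0 of this quadratic, so \<open>q z\<close> is nonpositive; being
        nonnegative as well, it is 0.\<close>
      hence "q z = (J \<bullet> z) * (1 + c * (J \<bullet> z))"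
        using qM[OF z(1)] by (simp add: algebra_simps power2_eq_square)
      hence "q z \<le> 0" using bounds by (simp add: mult_nonpos_nonneg)
      hence "q z = 0" using complement_form_nonneg[OF \<alpha>, of N H z] by (simp add: q_def)
      moreover have "z \<noteq> 0\<^sub>v N"
      proof
        assume "z = 0\<^sub>v N"
        hence "J = 0\<^sub>v N" using z(2) M by (auto simp: mult_mat_vec_def)
        hence "J $ 0 = 0" using n0 by simp
        thus False using n0 by (simp add: J_def)
      qed
      ultimately show ?thesis using z(1) by blast
    qed
    then obtain z where z: "z \<in> carrier_vec N" "z \<noteq> 0\<^sub>v N" "q z = 0" by blast
    then obtain v where "v < N" "z $ v \<noteq> 0" by (metis carrier_vecD eq_vecI index_zero_vec)
    hence "v \<in> I" using supp z(3) by blast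
    hence "0 < card I" using fin card_gt_0_iff by blast
    thus ?thesis using True by simp
  next
    case False
    hence m2: "2 \<le> m" using m by simp
    show ?thesis
    proof (rule ccontr)
      assume "\<not> m \<le> card I"
      \<comment> \<open>The number of equations: one for sum 0, and one for each vertex of
        \<open>I\<close> except the first. The maximum covers an empty \<open>I\<close>;
        \<open>k < m\<close> uses \<open>2 \<le> m\<close>.\<close>
      define k where "k = max (card I) 1"
      have k: "k < m" using \<open>\<not> m \<le> card I\<close> m2 by (simp add: k_def)
      define vs where "vs = sorted_list_of_set I"
      have vs: "set vs = I" "length vs = card I" using fin by (auto simp: vs_def)
      \<comment> \<open>Vectors on the clique with sum 0 whose image vanishes on all but one vertex of \<open>I\<close>.\<close>
      define a where "a i j = (if i = 0 then 1 else P\<^sup>T $$ (vs ! i, n + j))" for i j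
      obtain g' where g': "g' \<in> carrier_vec m" "g' \<noteq> 0\<^sub>v m"
        "\<And>i. i < k \<Longrightarrow> (\<Sum>j = 0..<m. a i j * g' $ j) = 0"
        using homogeneous_system_nontrivial[OF k, of a] by blast
      define g where "g = vec N (\<lambda>i. if n \<le> i then g' $ (i - n) else 0)"
      have g: "g \<in> carrier_vec N" by (simp add: g_def)
      have sum_g: "(\<Sum>i = 0..<N. f i * g $ i) = (\<Sum>j = 0..<m. f (n + j) * g' $ j)" for f :: "nat \<Rightarrow> real"
      proof -
        have "(\<Sum>i = 0..<N. f i * g $ i) = (\<Sum>i = n..<N. f i * g $ i)"
          by (rule sum.mono_neutral_right) (auto simp: g_def)
        also have "\<dots> = (\<Sum>i = n..<n + m. f i * g' $ (i - n))"
          by (intro sum.cong) (auto simp: g_def N_def)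
        also have "\<dots> = (\<Sum>j = 0..<m. f (n + j) * g' $ j)"
          using sum.shift_bounds_nat_ivl[of "\<lambda>i. f i * g' $ (i - n)" 0 n m] by (simp add: add.commute)
        finally show ?thesis .
      qed
      have "J \<bullet> g = (\<Sum>i = 0..<N. 1 * g $ i)" using g by (simp add: J_def scalar_prod_def)
      also have "\<dots> = 0" unfolding sum_g using g'(3)[of 0] by (simp add: a_def k_def)
      finally have Jg: "J \<bullet> g = 0" .
      define u where "u = P\<^sup>T *\<^sub>v g"
      have u: "u \<in> carrier_vec N" using P g by (simp add: u_def)
      \<comment> \<open>On the clique \<open>L\<close> acts as \<open>-c\<close> times the all-ones
        matrix, so a vector there with sum 0 is in the kernel.\<close>
      have "L *\<^sub>v g = 0 \<cdot>\<^sub>v g"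
        using Ldom[OF g] J g unfolding Jg by (auto simp: g_def N_def intro!: eq_vecI)
      from eigenvector_conjugate[OF P(1,2) L g this]
      have "M *\<^sub>v u = 0 \<cdot>\<^sub>v u" and Pu: "P *\<^sub>v u = g" by (auto simp: MP u_def)
      hence Mu: "M *\<^sub>v u = 0\<^sub>v N" using u by (auto intro!: eq_vecI)
      have uI: "u $ (vs ! i) = 0" if "i < card I" "i \<noteq> 0" for i
      proof -
        have "vs ! i \<in> I" using that vs by (metis nth_mem)
        hence vN: "vs ! i < N" by (simp add: I_def dominating_def)
        have "u $ (vs ! i) = (\<Sum>j = 0..<N. P\<^sup>T $$ (vs ! i, j) * g $ j)"
          unfolding u_def using P(1) g vN by (simp add: scalar_prod_def)
        also have "\<dots> = (\<Sum>j = 0..<m. a i j * g' $ j)" unfolding sum_g a_def using that by simp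
        also have "\<dots> = 0" using that by (intro g'(3)) (simp add: k_def)
        finally show ?thesis .
      qed
      have u0: "u $ v = 0" if "v < N" "v \<noteq> vs ! 0" for v
      proof (rule ccontr)
        assume nz: "u $ v \<noteq> 0"
        hence "v \<in> set vs" using supp[OF ker(2)[OF u Mu] that(1)] vs by simp
        then obtain i where "i < card I" "v = vs ! i" using vs by (metis in_set_conv_nth)
        thus False using uI nz that(2) by (cases "i = 0") auto
      qed
      \<comment> \<open>Only the entry at \<open>vs ! 0\<close> is left, and it equals the sum of
        \<open>u\<close>, which is 0. For empty \<open>I\<close> the index \<open>vs ! 0\<close> is
        unspecified, but the argument still applies.\<close>
      have uz: "u $ v = 0" if "v < N" for v
      proof (cases "v = vs ! 0")
        case True
        have "0 = J \<bullet> u" using ker(1)[OF u Mu] by simp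
        also have "\<dots> = (\<Sum>i = 0..<N. u $ i)" using u by (simp add: J_def scalar_prod_def)
        also have "\<dots> = (\<Sum>i = 0..<N. if i = v then u $ v else 0)"
          using u0 True by (intro sum.cong) auto
        also have "\<dots> = u $ v" using that by simp
        finally show ?thesis by simp
      qed (use u0 that in auto)
      hence "u = 0\<^sub>v N" using u by (intro eq_vecI) auto
      hence "g = 0\<^sub>v N" using Pu P(1) by (auto simp: mult_mat_vec_def)
      have "g' $ j = 0" if "j < m" for j
      proof -
        have "g $ (n + j) = g' $ j" using that by (simp add: g_def N_def)
        thus ?thesis using \<open>g = 0\<^sub>v N\<close> that by (simp add: N_def)
      qed
      hence "g' = 0\<^sub>v m" using g'(1) by (intro eq_vecI) auto
      thus False using g'(2) by simp
    qed
  qed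
  thus ?thesis by (simp add: I_def N_def)
qed

section \<open>Splitting off and cancelling the clique\<close>

lemma graph_join_index:
  assumes "i < n + m" "j < n + m"
  shows "graph_join n E m (complete_graph m) i j \<longleftrightarrow> (if i < n \<and> j < n then E i j else i \<noteq> j)"
  using assms by (auto simp: graph_join_def complete_graph_def)

text \<open>Exactly \<open>m\<close> dominating vertices are renumbered to come last. Any pair of
  distinct vertices meeting them is adjacent, and the other \<open>n\<close> vertices, possibly with
  further dominating ones among them, induce \<open>F\<close>.\<close>

lemma join_decomposition:
  assumes H: "is_graph (n + m) H" and card: "m \<le> card (dominating (n + m) H)"
  shows "\<exists>F. is_graph n F \<and> graph_iso (n + m) H (n + m) (graph_join n F m (complete_graph m))"
proof -
  have irr: "\<not> H i i" and symH: "H i j = H j i" for i j using H unfolding is_graph_def by blast+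
  obtain J where J: "J \<subseteq> dominating (n + m) H" "card J = m"
    using obtain_subset_with_card_n[OF card] by blast
  have sub: "J \<subseteq> {..<n + m}" using J(1) by (auto simp: dominating_def)
  hence fin: "finite J" by (rule finite_subset) simp
  have "card ({..<n + m} - J) = card {..<n}" using card_Diff_subset[OF fin sub] J(2) by simp
  then obtain f1 where f1: "bij_betw f1 ({..<n + m} - J) {..<n}"
    using finite_same_card_bij[of "{..<n + m} - J" "{..<n}"] by auto
  obtain f2 where f2: "bij_betw f2 J {n..<n + m}"
    using finite_same_card_bij[of J "{n..<n + m}"] fin J(2) by auto
  define f where "f v = (if v \<in> J then f2 v else f1 v)" for v
  have b1: "bij_betw f ({..<n + m} - J) {..<n}"
    using f1 by (subst bij_betw_cong[of _ _ f1]) (auto simp: f_def)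
  have b2: "bij_betw f J {n..<n + m}"
    using f2 by (subst bij_betw_cong[of _ _ f2]) (auto simp: f_def)
  have un: "({..<n + m} - J) \<union> J = {..<n + m}" "{..<n} \<union> {n..<n + m} = {..<n + m}"
    and disj: "{..<n} \<inter> {n..<n + m} = {}" using sub by auto
  have f: "bij_betw f {..<n + m} {..<n + m}"
    using bij_betw_combine[OF b1 b2 disj] unfolding un .
  define g where "g = inv_into {..<n + m} f"
  have gf: "g (f v) = v" if "v < n + m" for v
    unfolding g_def using bij_betw_inv_into_left[OF f, of v] that by simp
  define F where "F i j \<longleftrightarrow> i < n \<and> j < n \<and> H (g i) (g j)" for i j
  have F: "is_graph n F" unfolding is_graph_def F_def using irr symH by blast
  have fn: "f v < n + m" "f v < n \<longleftrightarrow> v \<notin> J" if "v < n + m" for v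
    using that bij_betwE[OF b1] bij_betwE[OF b2] by (force simp: not_less)+
  have domJ: "H i j \<longleftrightarrow> i \<noteq> j" if "i \<in> J \<or> j \<in> J" "i < n + m" "j < n + m" for i j
    using that J(1) irr symH by (auto simp: dominating_def)
  have inj: "f i = f j \<longleftrightarrow> i = j" if "i < n + m" "j < n + m" for i j
    using that gf by metis
  have "H i j = graph_join n F m (complete_graph m) (f i) (f j)" if "i < n + m" "j < n + m" for i j
    using that by (auto simp: graph_join_index fn inj F_def gf domJ)
  hence "graph_iso (n + m) H (n + m) (graph_join n F m (complete_graph m))"
    unfolding graph_iso_def using f by blast
  thus ?thesis using F by blast
qed

text \<open>The function \<open>h\<close> is a parameter so that one computation serves both the sum
  and the sum of squares.\<close>

lemma degree_sums_join:
  "(\<Sum>i = 0..<n + m. h (real (degree (n + m) (graph_join n E m (complete_graph m)) i))) =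
    (\<Sum>i = 0..<n. h (real (degree n E i) + real m)) + real m * h (real (n + m - 1))"
proof -
  define d where "d i = h (real (degree (n + m) (graph_join n E m (complete_graph m)) i))" for i
  have "(\<Sum>i = 0..<n + m. d i) = (\<Sum>i = 0..<n. d i) + (\<Sum>i = n..<n + m. d i)"
    by (simp add: sum.atLeastLessThan_concat)
  also have "(\<Sum>i = 0..<n. d i) = (\<Sum>i = 0..<n. h (real (degree n E i) + real m))"
    by (simp add: d_def degree_join_left)
  also have "(\<Sum>i = n..<n + m. d i) = (\<Sum>i = n..<n + m. h (real (n + m - 1)))"
    unfolding d_def by (intro sum.cong refl) (simp only: degree_join_right atLeastLessThan_iff)
  also have "\<dots> = real m * h (real (n + m - 1))"
    by (simp only: sum_constant card_atLeastLessThan add_diff_cancel_left')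
  finally show ?thesis by (simp add: d_def)
qed

text \<open>Joining raises the \<open>n\<close> degrees by \<open>m\<close> and adds the same clique
  degrees for \<open>E\<close> and \<open>F\<close>, so the two degree sums of the joins determine
  those of the graphs.\<close>

lemma regular_if_join_cospectral:
  assumes E: "is_graph n E" "regular n E r" and F: "is_graph n F" and \<alpha>: "\<alpha> \<noteq> 0"
    and cp: "char_poly (A_alpha \<alpha> (n + m) (graph_join n F m (complete_graph m))) =
      char_poly (A_alpha \<alpha> (n + m) (graph_join n E m (complete_graph m)))"
  shows "regular n F r"
proof (rule regular_if_degree_sums)
  note sums = cospectral_degree_sums[OF is_graph_join[OF F] is_graph_join[OF E(1)] \<alpha> cp]
  have d: "degree n E i = r" if "i < n" for i using E(2) that by (simp add: regular_def)
  have "(\<Sum>i = 0..<n. real (degree n F i) + real m) = (\<Sum>i = 0..<n. real (degree n E i) + real m)"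
    using sums(1) degree_sums_join[of "\<lambda>x. x" n m F] degree_sums_join[of "\<lambda>x. x" n m E] by simp
  thus 1: "(\<Sum>i = 0..<n. real (degree n F i)) = real n * real r"
    by (simp add: sum.distrib d algebra_simps)
  have "(\<Sum>i = 0..<n. (real (degree n F i) + real m)\<^sup>2) = (\<Sum>i = 0..<n. (real (degree n E i) + real m)\<^sup>2)"
    using sums(2) degree_sums_join[of "\<lambda>x. x\<^sup>2" n m F] degree_sums_join[of "\<lambda>x. x\<^sup>2" n m E] by simp
  also have "\<dots> = real n * (real r + real m)\<^sup>2" by (simp add: d)
  also have "(\<Sum>i = 0..<n. (real (degree n F i) + real m)\<^sup>2) = (\<Sum>i = 0..<n. (real (degree n F i))\<^sup>2)
      + 2 * real m * (\<Sum>i = 0..<n. real (degree n F i)) + real n * (real m)\<^sup>2"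
    by (simp add: power2_sum sum.distrib sum_distrib_left mult_ac)
  finally show "(\<Sum>i = 0..<n. (real (degree n F i))\<^sup>2) = real n * (real r)\<^sup>2"
    unfolding 1 by (simp add: power2_sum algebra_simps)
qed

lemma complete_if_regular:
  assumes "is_graph n E" "regular n E (n - 1)" "i < n" "j < n"
  shows "E i j \<longleftrightarrow> i \<noteq> j"
proof -
  have "i \<in> dominating n E"
    using assms by (intro dominating_if_degree) (auto simp: regular_def)
  thus ?thesis using assms unfolding dominating_def is_graph_def by blast
qed

text \<open>If \<open>r < n - 1\<close>, the degree \<open>r + m\<close> separates the vertices of
  the graph from the clique, so the isomorphism restricts. If \<open>r = n - 1\<close>, it may mix
  the two, but then both graphs are complete.\<close>

lemma graph_join_cancel:
  assumes E: "is_graph n E" "regular n E r" and F: "is_graph n F" "regular n F r" and r: "r \<le> n - 1"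
    and iso: "graph_iso (n + m) (graph_join n E m (complete_graph m))
      (n + m) (graph_join n F m (complete_graph m))"
  shows "graph_iso n E n F"
proof (cases "r = n - 1")
  case True
  hence "E i j = F i j" if "i < n" "j < n" for i j
    using complete_if_regular[of n E i j] complete_if_regular[of n F i j] E F that by simp
  thus ?thesis unfolding graph_iso_def by (intro exI[of _ id]) auto
next
  case False
  obtain f where f: "bij_betw f {..<n + m} {..<n + m}"
    and fiso: "\<forall>i<n + m. \<forall>j<n + m. graph_join n E m (complete_graph m) i j =
      graph_join n F m (complete_graph m) (f i) (f j)"
    using iso unfolding graph_iso_def by blast
  have fm: "f i < n + m" if "i < n + m" for i using bij_betwE[OF f] that by auto
  have fn: "f i < n" if i: "i < n" for i
  proof (rule ccontr)
    assume "\<not> f i < n"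
    hence "degree (n + m) (graph_join n F m (complete_graph m)) (f i) = n + m - 1"
      using fm[of i] i by (intro degree_join_right) auto
    moreover have "degree (n + m) (graph_join n F m (complete_graph m)) (f i) = r + m"
      using iso_preserves_degree[OF f fiso, of i] i E(2) by (simp add: degree_join_left regular_def)
    ultimately show False using False r i by simp
  qed
  have "inj_on f {..<n}" using f unfolding bij_betw_def by (auto intro: inj_on_subset)
  moreover from this have "f ` {..<n} = {..<n}" using fn by (intro endo_inj_surj) auto
  ultimately have "bij_betw f {..<n} {..<n}" by (simp add: bij_betw_def)
  moreover have "E i j = F (f i) (f j)" if "i < n" "j < n" for i j
  proof -
    have "graph_join n E m (complete_graph m) i j = graph_join n F m (complete_graph m) (f i) (f j)"
      using fiso that by simp
    thus ?thesis using that fn fm by (simp add: graph_join_index)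
  qed
  ultimately show ?thesis unfolding graph_iso_def by blast
qed

text \<open>This adds the case of complete \<open>E\<close>: the join is then complete, and a
  cospectral mate is regular of the same valency, so all its vertices dominate.\<close>

lemma card_dominating_ge_if_regular:
  assumes E: "is_graph n E" and reg: "regular n E r" and n: "1 \<le> n" and r: "r \<le> n - 1" and m: "1 \<le> m"
    and \<alpha>: "1/2 < \<alpha>" "\<alpha> < 1" and H: "is_graph (n + m) H"
    and cp: "char_poly (A_alpha \<alpha> (n + m) H) =
      char_poly (A_alpha \<alpha> (n + m) (graph_join n E m (complete_graph m)))"
  shows "m \<le> card (dominating (n + m) H)"
proof (cases "r = n - 1")
  case True
  have "regular (n + m) (graph_join n E m (complete_graph m)) (n + m - 1)"
    unfolding regular_def
  proof (intro allI impI)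
    fix i assume "i < n + m"
    thus "degree (n + m) (graph_join n E m (complete_graph m)) i = n + m - 1"
      using reg True n degree_join_left[of i n m E] degree_join_right[of n i m E]
      by (cases "i < n") (auto simp: regular_def)
  qed
  hence "regular (n + m) H (n + m - 1)"
    using regular_if_cospectral[OF H is_graph_join[OF E] _ _ cp] \<alpha> by simp
  hence "dominating (n + m) H = {..<n + m}"
    using dominating_if_degree[OF H] by (auto simp: regular_def dominating_def[of "n + m" H])
  thus ?thesis by simp
next
  case False
  thus ?thesis using r by (intro card_dominating_ge[OF E reg _ m \<alpha> H cp]) simp
qed

theorem theorem3p6:
  fixes n m r :: nat and E :: "nat \<Rightarrow> nat \<Rightarrow> bool" and \<alpha> :: real
  assumes "is_graph n E" and "regular n E r"
    and "1 \<le> n" and "r \<le> n - 1"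
    and "1 \<le> m"
    and "1/2 < \<alpha>" and "\<alpha> < 1"
  shows "determined_by_A_alpha_spectrum \<alpha> n E \<longleftrightarrow>
         determined_by_A_alpha_spectrum \<alpha> (n + m) (graph_join n E m (complete_graph m))"
proof
  note E = assms(1,2)
  have \<alpha>: "\<alpha> \<noteq> 0" using assms by simp
  let ?join = "\<lambda>F. graph_join n F m (complete_graph m)"
  {
    assume det: "determined_by_A_alpha_spectrum \<alpha> n E"
    show "determined_by_A_alpha_spectrum \<alpha> (n + m) (?join E)"
      unfolding determined_by_A_alpha_spectrum_def
    proof (intro allI impI, elim conjE)
      fix N H assume H: "is_graph N H" and "A_alpha_spectrum \<alpha> N H = A_alpha_spectrum \<alpha> (n + m) (?join E)"
      hence N: "N = n + m" and "char_poly (A_alpha \<alpha> N H) = char_poly (A_alpha \<alpha> (n + m) (?join E))"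
        unfolding A_alpha_spectrum_eq_iff by auto
      hence cp: "char_poly (A_alpha \<alpha> (n + m) H) = char_poly (A_alpha \<alpha> (n + m) (?join E))" by simp
      have H: "is_graph (n + m) H" using H N by simp
      obtain F where F: "is_graph n F" and iso: "graph_iso (n + m) H (n + m) (?join F)"
        using join_decomposition[OF H card_dominating_ge_if_regular[OF assms H cp]] by blast
      have cpF: "char_poly (A_alpha \<alpha> (n + m) (?join F)) = char_poly (A_alpha \<alpha> (n + m) (?join E))"
        using graph_iso_char_poly[OF iso, of \<alpha>] cp by simp
      \<comment> \<open>Regularity of \<open>F\<close> has to come from the degree sums of the joins
        first; only then can the clique be cancelled from the characteristic polynomials.\<close>
      have "regular n F r" by (rule regular_if_join_cospectral[OF E F \<alpha> cpF])
      hence "A_alpha_spectrum \<alpha> n F = A_alpha_spectrum \<alpha> n E"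
        unfolding A_alpha_spectrum_eq_iff using join_cospectral_iff[OF F _ E] cpF by blast
      hence "graph_iso n F n E"
        using det F unfolding determined_by_A_alpha_spectrum_def by blast
      thus "graph_iso N H (n + m) (?join E)"
        unfolding N by (rule graph_iso_trans[OF iso graph_join_iso])
    qed
  next
    assume det: "determined_by_A_alpha_spectrum \<alpha> (n + m) (?join E)"
    show "determined_by_A_alpha_spectrum \<alpha> n E"
      unfolding determined_by_A_alpha_spectrum_def
    proof (intro allI impI, elim conjE)
      fix k F assume F: "is_graph k F" and "A_alpha_spectrum \<alpha> k F = A_alpha_spectrum \<alpha> n E"
      hence k: "k = n" and "char_poly (A_alpha \<alpha> k F) = char_poly (A_alpha \<alpha> n E)"
        unfolding A_alpha_spectrum_eq_iff by auto
      hence cp: "char_poly (A_alpha \<alpha> n F) = char_poly (A_alpha \<alpha> n E)" by simp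
      have F: "is_graph n F" using F k by simp
      have reg: "regular n F r" by (rule regular_if_cospectral[OF F E(1) \<alpha> E(2) cp])
      have "A_alpha_spectrum \<alpha> (n + m) (?join F) = A_alpha_spectrum \<alpha> (n + m) (?join E)"
        unfolding A_alpha_spectrum_eq_iff using join_cospectral_iff[OF F reg E] cp by blast
      hence "graph_iso (n + m) (?join F) (n + m) (?join E)"
        using det is_graph_join[OF F] unfolding determined_by_A_alpha_spectrum_def by blast
      thus "graph_iso k F n E"
        unfolding k by (rule graph_join_cancel[OF F reg E assms(4)])
    qed
  }
qed

end
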